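(* Let $m:=\left(\frac12+\frac1{70}\right)n\log n$. With high probability, $G_m$ contains isolated vertices.
   Context: Let $n$ be an even integer, $V$ a set of $n$ vertices, $N=\binom n2$. For a graph $G$, $\nu(G)$ is the size of a maximum matching and $\tau(G)$ the minimum cardinality of a vertex cover (a set of vertices incident to every edge). $G$ is a König graph if $\nu(G)=\tau(G)$. The König process: let $e_1,\dots,e_N$ be a uniformly random ordering of the edges of the complete graph on $V$. $G_0$ is the empty graph on $V$. For $0\le m<N$, $G_{m+1}=G_m+e_{m+1}$ if $G_m+e_{m+1}$ is König, and $G_{m+1}=G_m$ otherwise. An event holds with high probability if its probability tends to $1$ as $n\to\infty$ (through even integers). $\log$ is the natural logarithm; rounding of time indices to integers is ignored. *)

theory Defs
  imports
    "HOL-Probability.Probability"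
    "HOL-Library.Ramsey"
    "HOL-Library.Disjoint_Sets"
    "HOL-Combinatorics.Multiset_Permutations"
begin

text \<open>
  A simple graph on a vertex set \<open>V\<close> is given by its edge set \<open>E \<subseteq> nsets V 2\<close>, each edge being
  a two-element subset of \<open>V\<close>; \<open>nsets V 2\<close> itself is the edge set of the complete graph on \<open>V\<close>.
\<close>

definition matching :: "'a set set \<Rightarrow> 'a set set \<Rightarrow> bool" where
  "matching E M \<longleftrightarrow> M \<subseteq> E \<and> disjoint M"

definition matching_number :: "'a set set \<Rightarrow> nat" where
  "matching_number E = Max {card M | M. matching E M}"

definition vertex_cover :: "'a set \<Rightarrow> 'a set set \<Rightarrow> 'a set \<Rightarrow> bool" where
  "vertex_cover V E C \<longleftrightarrow> C \<subseteq> V \<and> (\<forall>e\<in>E. \<exists>v\<in>C. v \<in> e)"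

definition cover_number :: "'a set \<Rightarrow> 'a set set \<Rightarrow> nat" where
  "cover_number V E = Min {card C | C. vertex_cover V E C}"

definition konig_graph :: "'a set \<Rightarrow> 'a set set \<Rightarrow> bool" where
  "konig_graph V E \<longleftrightarrow> matching_number E = cover_number V E"

definition isolated_vertex :: "'a set \<Rightarrow> 'a set set \<Rightarrow> 'a \<Rightarrow> bool" where
  "isolated_vertex V E v \<longleftrightarrow> v \<in> V \<and> (\<forall>e\<in>E. v \<notin> e)"

text \<open>
  The list \<open>es\<close> is the ordering of the edges of the complete graph; \<open>es ! m\<close> is the edge
  $e_{m+1}$, since lists are indexed from 0. The process is only of interest up to
  time \<open>length es\<close>, after which it is taken to be constant.
\<close>

primrec konig_process :: "'a set \<Rightarrow> 'a set list \<Rightarrow> nat \<Rightarrow> 'a set set" where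
  "konig_process V es 0 = {}"
| "konig_process V es (Suc m) =
     (if m < length es \<and> konig_graph V (insert (es ! m) (konig_process V es m))
      then insert (es ! m) (konig_process V es m)
      else konig_process V es m)"

definition edge_ordering :: "'a set \<Rightarrow> 'a set list pmf" where
  "edge_ordering V = pmf_of_set (permutations_of_set (nsets V 2))"

end

theory Submission
  imports Defs "HOL-Real_Asymp.Real_Asymp"
begin

text \<open>
  Let \<open>\<nu>\<close> be the matching number, \<open>d = n - 2\<nu>\<close> the deficiency and \<open>i \<le> d\<close> the number of isolated
  vertices of the current graph. A union bound over vertex sets shows that after \<open>O(n)\<close> steps
  the graph between a minimum cover \<open>C\<close> and its complement has edges between any two large sets.
  From then on a dichotomy holds for the set \<open>R\<close> of vertices outside \<open>C\<close> which some maximum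
  matching misses. If \<open>R\<close> is small, an isolated vertex only accepts edges to \<open>C\<close> and to few other
  vertices, so it loses its isolation at little more than half of the rate of the unrestricted
  process. If \<open>R\<close> is large, it contains almost everything outside \<open>C\<close>; then joining a missed
  vertex to \<open>R\<close> decreases \<open>d\<close> by 2 at once, and joining it to almost any vertex of \<open>C\<close> opens a
  second source of alternating paths, which leads to such a decrease within \<open>O(1)\<close> steps. So in the
  second case \<open>d\<close> decays at about twice the rate of \<open>i\<close>, and since \<open>i \<le> d\<close> this cannot last.
  Quantitatively, \<open>d / i^3\<close> (suitably modified) grows on average by a factor of at most
  \<open>1 + 3.8 / n\<close> in every step, from about \<open>n^(-2)\<close> at the start; as \<open>3.8 \<cdot> (1/2 + 1/70) < 2\<close>,
  it is still \<open>o(1)\<close> at time \<open>m\<close>, which excludes \<open>i = 0\<close>.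
\<close>

section \<open>Random orderings\<close>

text \<open>The exponent in \<open>d / i^3\<close> balances the two cases. Up to error terms, an
  isolated vertex is lost with probability \<open>1 / n\<close> per step if \<open>R\<close> is
  small and \<open>2 / n\<close> if it is large, and in the latter case \<open>d\<close> shrinks at
  relative rate \<open>4 / n\<close>. So \<open>d / i^a\<close> grows at rate \<open>a / n\<close>
  or \<open>(2 a - 4) / n\<close>, starting from about \<open>n^(1 - a)\<close>. At time
  \<open>n log n / 2\<close> the first rate needs \<open>a / 2 < a - 1\<close>, that is
  \<open>a > 2\<close>; the choice \<open>a = 3\<close> leaves room for the counting errors and for
  the extra \<open>n log n / 70\<close> steps. The cover is not part of the state and may change
  from step to step. The potential is therefore built from quantities that mention no cover, and
  each drift estimate chooses its own \<open>C\<close> and \<open>f\<close>. A second complication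
  is that the next pair is drawn only from those not offered before, rejected ones included; bounds
  on the number of offered pairs, in total and at each vertex, keep this from distorting the
  counts.\<close>

lemma sum_permutations_le:
  fixes \<Phi> :: "'b list \<Rightarrow> real"
  assumes "finite A" "t \<le> card A"
    and "\<And>xs. distinct xs \<Longrightarrow> set xs \<subseteq> A \<Longrightarrow> length xs < t \<Longrightarrow>
           (\<Sum>x\<in>A - set xs. \<Phi> (xs @ [x])) \<le> real (card A - length xs) * \<Phi> xs"
  shows "(\<Sum>es\<in>permutations_of_set A. \<Phi> (take t es)) \<le> fact (card A) * \<Phi> []"
  using assms
proof (induction t arbitrary: A \<Phi>)
  case 0
  then show ?case by simp
next
  case (Suc t)
  have ne: "A \<noteq> {}" using Suc.prems by auto
  \<comment> \<open>Condition on the first element \<open>x\<close>: the rest is an ordering of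
    \<open>A - {x}\<close>, and the induction hypothesis applies to
    \<open>\<lambda>xs. \<Phi> (x # xs)\<close>.\<close>
  have "(\<Sum>es\<in>permutations_of_set A. \<Phi> (take (Suc t) es)) =
        (\<Sum>x\<in>A. \<Sum>es\<in>(#) x ` permutations_of_set (A - {x}). \<Phi> (take (Suc t) es))"
    unfolding permutations_of_set_nonempty[OF ne]
    by (subst sum.UNION_disjoint) (use Suc.prems(1) in auto)
  also have "\<dots> = (\<Sum>x\<in>A. \<Sum>es\<in>permutations_of_set (A - {x}). \<Phi> (x # take t es))"
    by (rule sum.cong[OF refl]) (simp add: sum.reindex)
  also have "\<dots> \<le> (\<Sum>x\<in>A. fact (card A - 1) * \<Phi> [x])"
  proof (rule sum_mono)
    fix x assume x: "x \<in> A"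
    have "(\<Sum>es\<in>permutations_of_set (A - {x}). \<Phi> (x # take t es)) \<le>
          fact (card (A - {x})) * \<Phi> [x]"
    proof (rule Suc.IH)
      show "finite (A - {x})" "t \<le> card (A - {x})" using Suc.prems x by auto
      fix xs assume xs: "distinct xs" "set xs \<subseteq> A - {x}" "length xs < t"
      have "(\<Sum>y\<in>A - set (x # xs). \<Phi> ((x # xs) @ [y])) \<le> real (card A - length (x # xs)) * \<Phi> (x # xs)"
        by (rule Suc.prems(3)) (use xs x in auto)
      moreover have "A - {x} - set xs = A - set (x # xs)" by auto
      ultimately show "(\<Sum>y\<in>A - {x} - set xs. \<Phi> (x # xs @ [y])) \<le>
          real (card (A - {x}) - length xs) * \<Phi> (x # xs)"
        using x Suc.prems(1) by simp
    qed
    then show "(\<Sum>es\<in>permutations_of_set (A - {x}). \<Phi> (x # take t es)) \<le> fact (card A - 1) * \<Phi> [x]"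
      using x Suc.prems(1) by simp
  qed
  also have "\<dots> = fact (card A - 1) * (\<Sum>x\<in>A - set []. \<Phi> ([] @ [x]))"
    by (simp add: sum_distrib_left)
  also have "\<dots> \<le> fact (card A - 1) * (real (card A) * \<Phi> [])"
    using Suc.prems(3)[of "[]"] by (intro mult_left_mono) auto
  also have "\<dots> = fact (card A) * \<Phi> []"
    using Suc.prems(2) by (cases "card A") (auto simp: algebra_simps)
  finally show ?case .
qed

text \<open>Markov's inequality for a supermartingale stopped at the first bad prefix. The drift
  condition is demanded only at good prefixes, which lets properties that merely hold with high
  probability enter the argument.\<close>

lemma prob_permutations_le:
  fixes \<Phi> :: "'b list \<Rightarrow> real"
  assumes A: "finite A" "t \<le> card A" and a: "a > 0" and nn: "\<And>xs. 0 \<le> \<Phi> xs"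
    and step: "\<And>xs. distinct xs \<Longrightarrow> set xs \<subseteq> A \<Longrightarrow> length xs < t \<Longrightarrow> Good xs \<Longrightarrow>
           (\<Sum>x\<in>A - set xs. \<Phi> (xs @ [x])) \<le> real (card A - length xs) * \<Phi> xs"
  shows "measure_pmf.prob (pmf_of_set (permutations_of_set A))
           {es. a \<le> \<Phi> (take t es) \<and> (\<forall>s<t. Good (take s es))} \<le> \<Phi> [] / a"
proof -
  let ?P = "permutations_of_set A"
  \<comment> \<open>Only proper prefixes are tested, so the drift of \<open>\<Psi>\<close> at a list
    whose prefixes, itself included, are all good is that of \<open>\<Phi>\<close>; after a bad
    prefix the value stays 0.\<close>
  define \<Psi> where "\<Psi> xs = (if \<forall>s<length xs. Good (take s xs) then \<Phi> xs else 0)" for xs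
  have le: "(\<Sum>es\<in>?P. \<Psi> (take t es)) \<le> fact (card A) * \<Psi> []"
  proof (rule sum_permutations_le[OF A])
    fix xs assume xs: "distinct xs" "set xs \<subseteq> A" "length xs < t"
    show "(\<Sum>x\<in>A - set xs. \<Psi> (xs @ [x])) \<le> real (card A - length xs) * \<Psi> xs"
    proof (cases "\<forall>s<Suc (length xs). Good (take s xs)")
      case True
      then have "\<Psi> xs = \<Phi> xs" by (auto simp: \<Psi>_def)
      moreover have "Good xs" using True by auto
      moreover have "\<Psi> (xs @ [x]) = \<Phi> (xs @ [x])" for x
        using True by (auto simp: \<Psi>_def)
      ultimately show ?thesis using step[OF xs] by simp
    next
      case False
      then have "\<Psi> (xs @ [x]) = 0" for x by (auto simp: \<Psi>_def)
      then show ?thesis using nn by (simp add: \<Psi>_def)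
    qed
  qed
  let ?S = "{es\<in>?P. a \<le> \<Phi> (take t es) \<and> (\<forall>s<t. Good (take s es))}"
  have "real (card ?S) * a = (\<Sum>es\<in>?S. a)" by simp
  also have "\<dots> \<le> (\<Sum>es\<in>?S. \<Psi> (take t es))"
    by (rule sum_mono) (auto simp: \<Psi>_def min_def)
  also have "\<dots> \<le> (\<Sum>es\<in>?P. \<Psi> (take t es))"
    by (rule sum_mono2) (auto simp: \<Psi>_def nn)
  also note le
  finally have *: "real (card ?S) * a \<le> fact (card A) * \<Phi> []" by (simp add: \<Psi>_def)
  have "?P \<inter> {es. a \<le> \<Phi> (take t es) \<and> (\<forall>s<t. Good (take s es))} = ?S" by auto
  then have "measure_pmf.prob (pmf_of_set ?P) {es. a \<le> \<Phi> (take t es) \<and> (\<forall>s<t. Good (take s es))}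
     = real (card ?S) / fact (card A)"
    using A by (subst measure_pmf_of_set) (auto simp: Int_commute)
  also have "\<dots> \<le> \<Phi> [] / a"
    using * a by (simp add: field_simps)
  finally show ?thesis .
qed

section \<open>Matchings and covers of Koenig graphs\<close>

text \<open>The transition as a function of the offered pair alone, so that the drift at a given
  graph becomes a sum over pairs.\<close>

definition konig_step :: "'a set \<Rightarrow> 'a set \<Rightarrow> 'a set set \<Rightarrow> 'a set set" where
  "konig_step V e E = (if konig_graph V (insert e E) then insert e E else E)"

definition process_graph :: "'a set \<Rightarrow> 'a set list \<Rightarrow> 'a set set" where
  "process_graph V p = konig_process V p (length p)"

lemma konig_process_append:
  "t \<le> length p \<Longrightarrow> konig_process V (p @ q) t = konig_process V p t"
  by (induction t) (auto simp: nth_append)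

lemma process_graph_take:
  assumes "t \<le> length es"
  shows "process_graph V (take t es) = konig_process V es t"
proof -
  have "konig_process V (take t es @ drop t es) t = konig_process V (take t es) t"
    by (rule konig_process_append) (use assms in auto)
  then have "konig_process V es t = konig_process V (take t es) t" by (simp only: append_take_drop_id)
  moreover have "length (take t es) = t" using assms by simp
  ultimately show ?thesis unfolding process_graph_def by (simp only:)
qed

lemma process_graph_Nil [simp]: "process_graph V [] = {}"
  by (simp add: process_graph_def)

lemma process_graph_snoc [simp]:
  "process_graph V (p @ [e]) = konig_step V e (process_graph V p)"
  by (simp add: process_graph_def konig_step_def konig_process_append)

lemma process_graph_subset: "process_graph V p \<subseteq> set p"
  by (induction p rule: rev_induct) (auto simp: konig_step_def)

lemma process_graph_mono:
  assumes "s \<le> t" shows "process_graph V (take s p) \<subseteq> process_graph V (take t p)"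
  using assms
proof (induction rule: dec_induct)
  case base show ?case by simp
next
  case (step k)
  have "process_graph V (take k p) \<subseteq> process_graph V (take (Suc k) p)"
    by (cases "k < length p") (auto simp: take_Suc_conv_app_nth konig_step_def)
  with step.IH show ?case by (rule subset_trans)
qed

lemma doubleton_in_nsets_2: "{u, v} \<in> nsets V 2 \<longleftrightarrow> u \<in> V \<and> v \<in> V \<and> u \<noteq> v"
  by (auto simp: nsets_def card_insert_if)

lemma nsets_2_obtain:
  assumes "e \<in> nsets V 2"
  obtains u v where "e = {u, v}" "u \<noteq> v" "u \<in> V" "v \<in> V"
  using assms by (auto simp: nsets_def card_2_iff)

lemma finite_edges: "finite V \<Longrightarrow> E \<subseteq> nsets V 2 \<Longrightarrow> finite E"
  by (meson finite_imp_finite_nsets finite_subset)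

lemma matching_cards_finite: "finite E \<Longrightarrow> finite {card M |M. matching E M}"
  by (rule finite_subset[of _ "card ` Pow E"]) (auto simp: matching_def)

lemma card_le_matching_number:
  "finite E \<Longrightarrow> matching E M \<Longrightarrow> card M \<le> matching_number E"
  unfolding matching_number_def by (rule Max_ge[OF matching_cards_finite]) auto

lemma maximum_matching_exists:
  assumes "finite E"
  obtains M where "matching E M" "card M = matching_number E"
proof -
  have "matching E {}" by (simp add: matching_def disjoint_def)
  then have "{card M |M. matching E M} \<noteq> {}" by blast
  from Max_in[OF matching_cards_finite[OF assms] this] that show ?thesis
    unfolding matching_number_def by auto
qed

lemma cover_cards_finite: "finite V \<Longrightarrow> finite {card C |C. vertex_cover V E C}"
  by (rule finite_subset[of _ "card ` Pow V"]) (auto simp: vertex_cover_def)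

lemma cover_number_le:
  "finite V \<Longrightarrow> vertex_cover V E C \<Longrightarrow> cover_number V E \<le> card C"
  unfolding cover_number_def by (rule Min_le[OF cover_cards_finite]) auto

lemma minimum_cover_exists:
  assumes "finite V" "E \<subseteq> nsets V 2"
  obtains C where "vertex_cover V E C" "card C = cover_number V E"
proof -
  have "vertex_cover V E V"
    unfolding vertex_cover_def
  proof (intro conjI ballI subset_refl)
    fix e assume "e \<in> E"
    then have "e \<in> nsets V 2" using assms(2) by blast
    then obtain u v where "e = {u, v}" "u \<in> V" by (rule nsets_2_obtain)
    then show "\<exists>v\<in>V. v \<in> e" by blast
  qed
  then have "{card C |C. vertex_cover V E C} \<noteq> {}" by blast
  from Min_in[OF cover_cards_finite[OF assms(1)] this] that show ?thesis
    unfolding cover_number_def by auto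
qed

text \<open>Disjoint edges need distinct cover vertices. This is weak duality as an injection, a
  form that still says something when equality holds.\<close>

lemma matching_endpoints_in_cover:
  assumes "matching E M" "vertex_cover V E C"
  obtains g where "inj_on g M" "\<And>e. e \<in> M \<Longrightarrow> g e \<in> C \<and> g e \<in> e"
proof -
  have "\<forall>e\<in>M. \<exists>v. v \<in> C \<and> v \<in> e" using assms by (auto simp: matching_def vertex_cover_def)
  then obtain g where g: "\<And>e. e \<in> M \<Longrightarrow> g e \<in> C \<and> g e \<in> e" by metis
  moreover have "inj_on g M"
  proof (rule inj_onI, rule ccontr)
    fix e e' assume e: "e \<in> M" "e' \<in> M" "g e = g e'" "e \<noteq> e'"
    then have "e \<inter> e' = {}" using assms(1) by (simp add: matching_def disjoint_def)
    moreover have "g e \<in> e" "g e' \<in> e'" using g[OF e(1)] g[OF e(2)] by auto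
    ultimately show False using e(3) by auto
  qed
  ultimately show thesis using that by blast
qed

lemma card_matching_le_card_cover:
  assumes "finite V" "matching E M" "vertex_cover V E C"
  shows "card M \<le> card C"
proof -
  obtain g where "inj_on g M" "\<And>e. e \<in> M \<Longrightarrow> g e \<in> C \<and> g e \<in> e"
    using matching_endpoints_in_cover assms by metis
  moreover have "finite C" using assms by (auto simp: vertex_cover_def finite_subset)
  ultimately show ?thesis by (intro card_inj_on_le[of g]) auto
qed

lemma matching_number_le_cover_number:
  assumes "finite V" "E \<subseteq> nsets V 2"
  shows "matching_number E \<le> cover_number V E"
  using assms card_matching_le_card_cover maximum_matching_exists minimum_cover_exists finite_edges
  by metis

text \<open>A certificate for the Koenig property: the \<open>card C\<close> disjoint edges
  \<open>{c, f c}\<close> attain the bound given by the cover \<open>C\<close>. Encoding the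
  matching by \<open>f\<close> also records the partner outside \<open>C\<close> of each cover
  vertex.\<close>

definition konig_pair :: "'a set \<Rightarrow> 'a set set \<Rightarrow> 'a set \<Rightarrow> ('a \<Rightarrow> 'a) \<Rightarrow> bool" where
  "konig_pair V E C f \<longleftrightarrow> C \<subseteq> V \<and> inj_on f C \<and> f ` C \<subseteq> V - C \<and>
     (\<forall>c\<in>C. {c, f c} \<in> E) \<and> (\<forall>e\<in>E. e \<inter> C \<noteq> {})"

lemma konig_pair_matching:
  assumes "konig_pair V E C f"
  shows "matching E ((\<lambda>c. {c, f c}) ` C)" "card ((\<lambda>c. {c, f c}) ` C) = card C"
proof -
  have *: "c = d" if "c \<in> C" "d \<in> C" "{c, f c} \<inter> {d, f d} \<noteq> {}" for c d
    using assms that by (auto simp: konig_pair_def inj_on_def)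
  show "matching E ((\<lambda>c. {c, f c}) ` C)"
    unfolding matching_def disjoint_def
  proof (intro conjI ballI impI)
    show "(\<lambda>c. {c, f c}) ` C \<subseteq> E" using assms by (auto simp: konig_pair_def)
    fix a b assume "a \<in> (\<lambda>c. {c, f c}) ` C" "b \<in> (\<lambda>c. {c, f c}) ` C" "a \<noteq> b"
    then obtain c d where cd: "c \<in> C" "d \<in> C" "a = {c, f c}" "b = {d, f d}" "c \<noteq> d" by auto
    then show "a \<inter> b = {}" using *[of c d] by metis
  qed
  show "card ((\<lambda>c. {c, f c}) ` C) = card C"
    by (rule card_image, rule inj_onI) (rule *, auto)
qed

lemma konig_pair_cover: "konig_pair V E C f \<Longrightarrow> vertex_cover V E C"
  by (fastforce simp: konig_pair_def vertex_cover_def)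

lemma konig_pairD:
  assumes "finite V" "E \<subseteq> nsets V 2" "konig_pair V E C f"
  shows "matching_number E = card C" "cover_number V E = card C" "konig_graph V E"
proof -
  have "card C \<le> matching_number E"
    using card_le_matching_number[OF finite_edges[OF assms(1,2)]] konig_pair_matching[OF assms(3)]
    by metis
  moreover have "cover_number V E \<le> card C"
    using cover_number_le[OF assms(1) konig_pair_cover[OF assms(3)]] .
  ultimately show "matching_number E = card C" "cover_number V E = card C" "konig_graph V E"
    using matching_number_le_cover_number[OF assms(1,2)] by (auto simp: konig_graph_def)
qed

text \<open>When cover and matching have equal size, the injection from matching edges to cover
  vertices is onto, so no matching edge has both ends in \<open>C\<close>. Since \<open>C\<close>
  and \<open>M\<close> are arbitrary optimal choices, one cover can be kept while the matching
  varies.\<close>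

lemma konig_pair_exists:
  assumes "finite V" "E \<subseteq> nsets V 2"
    and C: "vertex_cover V E C" "card C = matching_number E"
    and M: "matching E M" "card M = matching_number E"
  obtains f where "konig_pair V E C f" "\<And>c. c \<in> C \<Longrightarrow> {c, f c} \<in> M"
proof -
  obtain g where g: "inj_on g M" "\<And>e. e \<in> M \<Longrightarrow> g e \<in> C \<and> g e \<in> e"
    using matching_endpoints_in_cover M C by metis
  have finC: "finite C" using C assms(1) by (auto simp: vertex_cover_def finite_subset)
  have "g ` M \<subseteq> C" using g by auto
  moreover have "card (g ` M) = card C" using card_image[OF g(1)] C M by simp
  ultimately have gM: "g ` M = C" using finC by (simp add: card_subset_eq)
  have dis: "e = e'" if "e \<in> M" "e' \<in> M" "v \<in> e" "v \<in> e'" for e e' v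
    using M(1) that by (auto simp: matching_def disjoint_def)
  have "\<exists>w. w \<in> V - C \<and> {c, w} \<in> M" if "c \<in> C" for c
  proof -
    obtain e where e: "e \<in> M" "c = g e" using gM \<open>c \<in> C\<close> by blast
    then have "e \<in> nsets V 2" using M(1) assms(2) by (auto simp: matching_def)
    moreover have "c \<in> e" using g(2)[OF e(1)] unfolding e(2)[symmetric] by blast
    ultimately obtain w where w: "e = {c, w}" "c \<noteq> w" "w \<in> V"
      by (elim nsets_2_obtain) auto
    have "w \<notin> C"
    proof
      assume "w \<in> C"
      then obtain e' where e': "e' \<in> M" "w = g e'" using gM by blast
      have "w \<in> e'" using g(2)[OF e'(1)] e'(2) by simp
      moreover have "w \<in> e" by (simp only: w(1) insert_iff simp_thms)
      ultimately have "e' = e" using dis[OF e'(1) e(1)] by blast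
      then have "w = c" using e'(2) e(2) by (simp only:)
      then show False using w(2) by simp
    qed
    moreover have "{c, w} \<in> M" using e(1) w(1) by (simp only:)
    ultimately show ?thesis using w(3) by blast
  qed
  then obtain f where f: "\<And>c. c \<in> C \<Longrightarrow> f c \<in> V - C \<and> {c, f c} \<in> M" by metis
  have "inj_on f C"
  proof (rule inj_onI)
    fix c d assume cd: "c \<in> C" "d \<in> C" "f c = f d"
    then have "{c, f c} = {d, f d}" using dis[of "{c, f c}" "{d, f d}" "f c"] f[of c] f[of d] by simp
    then show "c = d" using cd f[of c] f[of d] by (auto simp: doubleton_eq_iff)
  qed
  moreover have "C \<subseteq> V" "\<forall>e\<in>E. e \<inter> C \<noteq> {}" using C by (auto simp: vertex_cover_def)
  ultimately have "konig_pair V E C f"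
    using f M(1) by (auto simp: konig_pair_def matching_def)
  then show thesis using that f by auto
qed

lemma konig_graph_obtain_pair:
  assumes "finite V" "E \<subseteq> nsets V 2" "konig_graph V E"
  obtains C f where "konig_pair V E C f"
proof -
  obtain C where "vertex_cover V E C" "card C = cover_number V E"
    using minimum_cover_exists assms by metis
  moreover obtain M where "matching E M" "card M = matching_number E"
    using maximum_matching_exists finite_edges assms by metis
  ultimately show thesis
    using konig_pair_exists[OF assms(1,2)] assms(3) that unfolding konig_graph_def by metis
qed

lemma matching_number_mono:
  assumes "finite E'" "E \<subseteq> E'" shows "matching_number E \<le> matching_number E'"
proof -
  obtain M where "matching E M" "card M = matching_number E"
    using maximum_matching_exists finite_subset[OF assms(2,1)] by metis
  moreover from this have "matching E' M" using assms by (auto simp: matching_def)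
  ultimately show ?thesis using card_le_matching_number assms by metis
qed

lemma matching_number_insert_le:
  assumes "finite E" shows "matching_number (insert e E) \<le> Suc (matching_number E)"
proof -
  obtain M where M: "matching (insert e E) M" "card M = matching_number (insert e E)"
    using maximum_matching_exists assms by (metis finite_insert)
  have "matching E (M - {e})" using M by (auto simp: matching_def disjoint_def)
  then have "card (M - {e}) \<le> matching_number E" using card_le_matching_number assms by metis
  then show ?thesis using M(2) by (simp add: card_Diff_singleton_if split: if_splits)
qed

text \<open>One end of \<open>e\<close> added to a minimum cover also covers \<open>e\<close>, so
  the cover number rises by at most 1. Hence an edge that raises the matching number is never
  rejected.\<close>

lemma konig_graph_insert_if_matching_number:
  assumes "finite V" "E \<subseteq> nsets V 2" "konig_graph V E" "e \<in> nsets V 2"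
    and "matching_number E < matching_number (insert e E)"
  shows "konig_graph V (insert e E)"
proof -
  obtain C where C: "vertex_cover V E C" "card C = cover_number V E"
    using minimum_cover_exists assms by metis
  obtain u v where e: "e = {u, v}" "u \<in> V" using assms(4) nsets_2_obtain by metis
  have "vertex_cover V (insert e E) (insert u C)" using C e by (auto simp: vertex_cover_def)
  then have "cover_number V (insert e E) \<le> card (insert u C)"
    using cover_number_le assms(1) by metis
  also have "\<dots> \<le> Suc (card C)"
    by (metis card_insert_disjoint card.infinite finite_insert insert_absorb le_SucI order_refl
        zero_le)
  finally have "cover_number V (insert e E) \<le> matching_number (insert e E)"
    using assms(3,5) C by (simp add: konig_graph_def)
  moreover have "insert e E \<subseteq> nsets V 2" using assms by auto
  ultimately show ?thesis
    using matching_number_le_cover_number[OF assms(1)] by (auto simp: konig_graph_def le_antisym)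
qed

lemma konig_pair_insert:
  "konig_pair V E C f \<Longrightarrow> e \<inter> C \<noteq> {} \<Longrightarrow> konig_pair V (insert e E) C f"
  by (auto simp: konig_pair_def)

lemma konig_step_konig:
  "konig_graph V E \<Longrightarrow> konig_graph V (konig_step V e E)"
  by (simp add: konig_step_def)

lemma konig_graph_empty: "finite V \<Longrightarrow> konig_graph V {}"
  by (rule konig_pairD(3)[where C = "{}" and f = id]) (auto simp: konig_pair_def)

lemma process_graph_konig: "finite V \<Longrightarrow> konig_graph V (process_graph V p)"
  by (induction p rule: rev_induct) (auto simp: konig_graph_empty konig_step_konig)

lemma matching_number_augment:
  assumes V: "finite V" "E \<subseteq> nsets V 2" and f: "konig_pair V E C f"
    and xy: "x \<in> V - C - f ` C" "y \<in> V - C - f ` C" "x \<noteq> y"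
  shows "matching_number E < matching_number (insert {x, y} E)"
proof -
  define M where "M = (\<lambda>c. {c, f c}) ` C"
  have fin: "finite E" "finite C"
    using finite_edges V f by (auto simp: konig_pair_def finite_subset)
  have M: "M \<subseteq> E" "disjoint M" "card M = card C"
    using konig_pair_matching[OF f] by (auto simp: matching_def M_def)
  have new: "{x, y} \<inter> m = {}" if "m \<in> M" for m using that xy by (auto simp: M_def)
  have "disjoint (insert {x, y} M)"
    using M(2) new by (simp add: disjoint_def Int_commute)
  then have "matching (insert {x, y} E) (insert {x, y} M)"
    using M(1) by (auto simp: matching_def)
  moreover have "{x, y} \<notin> M" using new by blast
  then have "card (insert {x, y} M) = Suc (card C)"
    using M fin by (simp add: finite_subset)
  ultimately show ?thesis
    using card_le_matching_number[of "insert {x, y} E"] konig_pairD(1)[OF V f] fin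
    by (metis Suc_le_lessD finite_insert)
qed

section \<open>Alternating paths\<close>

text \<open>
  With \<open>konig_pair V E C f\<close> all alternating paths from missed vertices live outside \<open>C\<close>; contracting
  the matching edges \<open>{c, f c}\<close> turns them into directed paths on \<open>V - C\<close>.
\<close>

definition alt_arc :: "'a set set \<Rightarrow> 'a set \<Rightarrow> ('a \<Rightarrow> 'a) \<Rightarrow> 'a \<Rightarrow> 'a \<Rightarrow> bool" where
  "alt_arc E C f i j \<longleftrightarrow> (\<exists>c\<in>C. f c = j \<and> {i, c} \<in> E)"

definition alt_path :: "'a set set \<Rightarrow> 'a set \<Rightarrow> ('a \<Rightarrow> 'a) \<Rightarrow> 'a list \<Rightarrow> bool" where
  "alt_path E C f xs \<longleftrightarrow> xs \<noteq> [] \<and> distinct xs \<and> successively (alt_arc E C f) xs"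

text \<open>An arc uses \<open>f\<close> only through its target, hence only the tail of the path
  matters for \<open>f\<close>.\<close>

lemma alt_path_cong:
  assumes "alt_path E C f xs" "E \<subseteq> E'" "\<And>c. c \<in> C \<Longrightarrow> f c \<in> set (tl xs) \<Longrightarrow> g c = f c"
  shows "alt_path E' C g xs"
proof -
  have "successively (alt_arc E' C g) xs"
    if "successively (alt_arc E C f) xs" "\<And>c. c \<in> C \<Longrightarrow> f c \<in> set (tl xs) \<Longrightarrow> g c = f c" for xs
    using that
  proof (induction xs rule: induct_list012)
    case (3 x y zs)
    have "alt_arc E' C g x y" using 3 assms(2) by (fastforce simp: alt_arc_def)
    moreover have "successively (alt_arc E' C g) (y # zs)"
      by (rule 3(2)) (use 3 in \<open>auto dest: list.set_sel(2)\<close>)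
    ultimately show ?case by simp
  qed auto
  then show ?thesis using assms by (auto simp: alt_path_def)
qed

text \<open>Rematching each cover vertex on the path to the preceding vertex makes the last vertex
  missed instead of the first. That \<open>g\<close> agrees with \<open>f\<close> off the path
  allows a second, disjoint path to be swapped afterwards.\<close>

lemma alt_path_swap:
  assumes "konig_pair V E C f" "alt_path E C f xs" "hd xs \<in> V - C - f ` C"
  obtains g where "konig_pair V E C g" "g ` C \<subseteq> insert (hd xs) (f ` C) - {last xs}"
    "\<And>c. c \<in> C \<Longrightarrow> f c \<notin> set xs \<Longrightarrow> g c = f c"
proof -
  have "\<exists>g. konig_pair V E C g \<and> g ` C \<subseteq> insert (hd xs) (f ` C) - {last xs} \<and>
      (\<forall>c\<in>C. f c \<notin> set xs \<longrightarrow> g c = f c)"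
    using assms
  proof (induction xs arbitrary: f rule: induct_list012)
    case 1
    then show ?case by (simp add: alt_path_def)
  next
    case (2 x)
    then show ?case by (intro exI[of _ f]) auto
  next
    case (3 i j ys)
    obtain c where c: "c \<in> C" "f c = j" "{i, c} \<in> E"
      using 3 by (auto simp: alt_path_def alt_arc_def)
    \<comment> \<open>The first arc is swapped: \<open>c\<close> takes \<open>i\<close>, which
      leaves \<open>j\<close> missed, and the rest of the path starts there.\<close>
    let ?f = "f(c := i)"
    have inj: "inj_on f C" and i: "i \<in> V" "i \<notin> C" "i \<notin> f ` C"
      using 3 by (auto simp: konig_pair_def)
    have pair: "konig_pair V E C ?f"
      using 3(3) i c inj by (auto simp: konig_pair_def inj_on_def insert_commute)
    have j: "j \<notin> ?f ` C" using c inj i by (auto simp: inj_on_def)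
    have "alt_path E C ?f (j # ys)"
    proof (rule alt_path_cong)
      show "alt_path E C f (j # ys)" using 3(4) by (auto simp: alt_path_def)
      show "(?f) d = f d" if "d \<in> C" "f d \<in> set (tl (j # ys))" for d
        using that 3(4) c by (auto simp: alt_path_def)
    qed simp
    moreover have "hd (j # ys) \<in> V - C - ?f ` C" using c 3(3) j by (auto simp: konig_pair_def)
    ultimately obtain g where g: "konig_pair V E C g"
      "g ` C \<subseteq> insert (hd (j # ys)) (?f ` C) - {last (j # ys)}"
      "\<forall>d\<in>C. (?f) d \<notin> set (j # ys) \<longrightarrow> g d = (?f) d"
      using 3(2)[OF pair] by blast
    have "g ` C \<subseteq> insert (hd (i # j # ys)) (f ` C) - {last (i # j # ys)}"
      using g(2) c by auto
    moreover have "g d = f d" if "d \<in> C" "f d \<notin> set (i # j # ys)" for d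
    proof -
      have "d \<noteq> c" using that(2) c(2) by auto
      then have "(?f) d = f d" by simp
      then show ?thesis using bspec[OF g(3) that(1)] that(2) by simp
    qed
    ultimately show ?case using g(1) by blast
  qed
  then show thesis using that by blast
qed

section \<open>Expanding Koenig graphs\<close>

text \<open>
  The property does not mention a cover, so that it is monotone in \<open>E\<close> and accessible to a union
  bound; it is used with \<open>V - I\<close> a minimum cover, which forces the edge to join \<open>S\<close> and \<open>T\<close>.
\<close>

definition expander :: "'a set \<Rightarrow> 'a set set \<Rightarrow> bool" where
  "expander V E \<longleftrightarrow> (\<forall>I S T. I \<subseteq> V \<and> S \<subseteq> V \<and> T \<subseteq> V \<and> card V \<le> 2 * card I \<and> T \<inter> I = {} \<and>
     S \<inter> T = {} \<and> card V \<le> 50 * card S \<and> card V \<le> 50 * card T \<longrightarrow>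
     (\<exists>e\<in>E. e \<subseteq> I \<or> (\<exists>s\<in>S. \<exists>t\<in>T. e = {s, t})))"

definition augmenting_pairs :: "'a set \<Rightarrow> 'a set set \<Rightarrow> 'a set set" where
  "augmenting_pairs V E = {e \<in> nsets V 2. matching_number E < matching_number (insert e E)}"

text \<open>About one pair in 50 or more is then augmenting, so the wait for the next increase of
  the matching number is bounded on average.\<close>

definition augmentable :: "'a set \<Rightarrow> 'a set set \<Rightarrow> bool" where
  "augmentable V E \<longleftrightarrow> (card V)^2 \<le> 100 * card (augmenting_pairs V E)"

text \<open>Out of a graph that is not augmentable, these are the pairs whose acceptance lowers
  \<open>shifted_deficiency\<close> by at least 2.\<close>

definition progress_pairs :: "'a set \<Rightarrow> 'a set set \<Rightarrow> 'a set set" where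
  "progress_pairs V E = {e \<in> nsets V 2. konig_graph V (insert e E) \<and>
     (matching_number E < matching_number (insert e E) \<or> augmentable V (insert e E))}"

definition neighbours :: "'a set set \<Rightarrow> 'a \<Rightarrow> 'a set" where
  "neighbours A v = {u. {v, u} \<in> A}"

lemma neighbours_subset: "A \<subseteq> nsets V 2 \<Longrightarrow> neighbours A v \<subseteq> V"
  by (auto simp: neighbours_def doubleton_in_nsets_2 dest!: subsetD)

text \<open>Discrete continuity: adding the sets one by one enlarges the union by less than
  \<open>m / k\<close> at a time, so its size cannot jump over the excluded window from
  \<open>m / k\<close> to \<open>2 m / k\<close>.\<close>

lemma card_Union_less:
  fixes k m :: nat
  assumes "finite \<A>" and "0 < m" and "\<And>A. A \<in> \<A> \<Longrightarrow> k * card A < m"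
    and "\<And>\<B>. \<B> \<subseteq> \<A> \<Longrightarrow> \<not> (m \<le> k * card (\<Union>\<B>) \<and> k * card (\<Union>\<B>) < 2 * m)"
  shows "k * card (\<Union>\<A>) < m"
  using assms
proof (induction \<A> rule: finite_induct)
  case empty
  then show ?case by simp
next
  case (insert A \<A>)
  have "k * card (\<Union>\<A>) < m" by (rule insert.IH) (use insert.prems in auto)
  moreover have "k * card (A \<union> \<Union>\<A>) \<le> k * (card A + card (\<Union>\<A>))"
    by (intro mult_le_mono2 card_Un_le)
  moreover have "k * card A < m" using insert.prems by auto
  ultimately have "k * card (\<Union>(insert A \<A>)) < 2 * m" by (simp add: distrib_left)
  then show ?case using insert.prems(3)[of "insert A \<A>"] by auto
qed

lemma sum_card_inter_eq_sum_neighbours: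
  assumes V: "finite V" and A: "A \<subseteq> nsets V 2" and J: "J \<subseteq> V"
  shows "(\<Sum>e\<in>A. card (e \<inter> J)) = (\<Sum>v\<in>J. card (neighbours A v))"
proof -
  have fin: "finite A" "finite J" using V A J finite_edges finite_subset by auto
  have fe: "finite e" if "e \<in> A" for e using that A by (auto simp: nsets_def)
  have "(\<Sum>e\<in>A. card (e \<inter> J)) = (\<Sum>e\<in>A. \<Sum>v\<in>J. if v \<in> e then 1 else 0)"
    using fin(2) by (intro sum.cong refl) (simp add: sum.If_cases Int_commute)
  also have "\<dots> = (\<Sum>v\<in>J. \<Sum>e\<in>A. if v \<in> e then 1 else 0)" by (rule sum.swap)
  also have "\<dots> = (\<Sum>v\<in>J. card (neighbours A v))"
  proof (rule sum.cong[OF refl])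
    fix v assume "v \<in> J"
    have "bij_betw (\<lambda>u. {v, u}) (neighbours A v) {e \<in> A. v \<in> e}"
    proof (rule bij_betwI')
      fix x y assume xy: "x \<in> neighbours A v" "y \<in> neighbours A v"
      then show "({v, x} = {v, y}) = (x = y)" by (auto simp: doubleton_eq_iff)
    next
      fix x assume "x \<in> neighbours A v"
      then show "{v, x} \<in> {e \<in> A. v \<in> e}" by (simp add: neighbours_def)
    next
      fix e assume e: "e \<in> {e \<in> A. v \<in> e}"
      then have "e \<in> nsets V 2" using A by auto
      then obtain a b where "e = {a, b}" by (rule nsets_2_obtain)
      then have "\<exists>u. e = {v, u}" using e by auto
      then show "\<exists>x\<in>neighbours A v. e = {v, x}" using e by (auto simp: neighbours_def)
    qed
    then have "card (neighbours A v) = card {e \<in> A. v \<in> e}" by (rule bij_betw_same_card)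
    also have "\<dots> = (\<Sum>e\<in>A. if v \<in> e then 1 else 0)"
      using fin(1) by (simp add: sum.If_cases Int_def)
    finally show "(\<Sum>e\<in>A. if v \<in> e then 1 else 0) = card (neighbours A v)" by simp
  qed
  finally show ?thesis .
qed

section \<open>Reachability along alternating paths\<close>

lemma alt_path_set: "alt_path E C f xs \<Longrightarrow> set xs \<subseteq> insert (hd xs) (f ` C)"
proof (induction xs rule: rev_induct)
  case (snoc x xs)
  then show ?case
    by (cases "xs = []") (auto simp: alt_path_def successively_append_iff alt_arc_def)
qed simp

text \<open>Cutting the path at \<open>f c\<close>, if \<open>f c\<close> already lies on it, keeps
  the vertices distinct.\<close>

lemma alt_path_extend:
  assumes "alt_path E C f xs" "c \<in> C" "{last xs, c} \<in> E"
  obtains ys where "alt_path E C f ys" "hd ys = hd xs" "last ys = f c"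
    "set ys \<subseteq> insert (f c) (set xs)" "length ys \<le> Suc (length xs)"
proof (cases "f c \<in> set xs")
  case True
  then obtain ys zs where xs: "xs = ys @ f c # zs" by (meson split_list)
  show thesis
  proof (rule that[of "ys @ [f c]"])
    show "alt_path E C f (ys @ [f c])"
      using assms(1) by (auto simp: alt_path_def xs successively_append_iff)
    show "hd (ys @ [f c]) = hd xs" by (cases ys) (auto simp: xs)
  qed (auto simp: xs)
next
  case False
  have "alt_arc E C f (last xs) (f c)" using assms by (auto simp: alt_arc_def)
  then show thesis
    using assms(1) False
    by (intro that[of "xs @ [f c]"]) (auto simp: alt_path_def successively_append_iff)
qed

text \<open>The forbidden set \<open>Z\<close> will be a first path that a second one has to
  avoid.\<close>

definition alt_reach :: "'a set set \<Rightarrow> 'a set \<Rightarrow> ('a \<Rightarrow> 'a) \<Rightarrow> 'a set \<Rightarrow> 'a \<Rightarrow> 'a set" where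
  "alt_reach E C f Z i = {last xs |xs. alt_path E C f xs \<and> hd xs = i \<and> set xs \<inter> Z = {}}"

definition alt_ball :: "'a set set \<Rightarrow> 'a set \<Rightarrow> ('a \<Rightarrow> 'a) \<Rightarrow> nat \<Rightarrow> 'a \<Rightarrow> 'a set" where
  "alt_ball E C f k i = {last xs |xs. alt_path E C f xs \<and> hd xs = i \<and> length xs \<le> Suc k}"

definition alt_closed :: "'a set set \<Rightarrow> 'a set \<Rightarrow> ('a \<Rightarrow> 'a) \<Rightarrow> 'a set \<Rightarrow> 'a set \<Rightarrow> bool" where
  "alt_closed E C f Z S \<longleftrightarrow> (\<forall>x\<in>S. \<forall>c\<in>C. {x, c} \<in> E \<longrightarrow> f c \<notin> Z \<longrightarrow> f c \<in> S)"

lemma alt_path_singleton: "alt_path E C f [i]"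
  by (simp add: alt_path_def)

lemma alt_reach_self: "i \<notin> Z \<Longrightarrow> i \<in> alt_reach E C f Z i"
  unfolding alt_reach_def by (force intro: exI[of _ "[i]"] alt_path_singleton)

lemma alt_path_last_mem: "alt_path E C f xs \<Longrightarrow> last xs \<in> set xs"
  by (simp add: alt_path_def)

lemma alt_reach_subset: "alt_reach E C f Z i \<subseteq> insert i (f ` C)"
  unfolding alt_reach_def using alt_path_set alt_path_last_mem by fastforce

lemma alt_reach_closed: "alt_closed E C f Z (alt_reach E C f Z i)"
  unfolding alt_closed_def
proof (intro ballI impI)
  fix x c assume x: "x \<in> alt_reach E C f Z i" and c: "c \<in> C" "{x, c} \<in> E" "f c \<notin> Z"
  obtain xs where xs: "alt_path E C f xs" "hd xs = i" "set xs \<inter> Z = {}" "x = last xs"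
    using x by (auto simp: alt_reach_def)
  obtain ys where "alt_path E C f ys" "hd ys = hd xs" "last ys = f c"
    "set ys \<subseteq> insert (f c) (set xs)"
    using alt_path_extend[OF xs(1) c(1)] c(2) xs(4) by metis
  moreover from this have "set ys \<inter> Z = {}" using xs(3) c(3) by auto
  ultimately show "f c \<in> alt_reach E C f Z i"
    unfolding alt_reach_def using xs(2) by (metis (mono_tags, lifting) mem_Collect_eq)
qed

lemma alt_closed_Union:
  "(\<And>S. S \<in> \<A> \<Longrightarrow> alt_closed E C f Z S) \<Longrightarrow> alt_closed E C f Z (\<Union>\<A>)"
  by (fastforce simp: alt_closed_def)

lemma alt_path_last_in_closed:
  assumes "alt_closed E C f {} S" "alt_path E C f xs" "hd xs \<in> S"
  shows "last xs \<in> S"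
  using assms(2,3)
proof (induction xs rule: rev_induct)
  case (snoc x xs)
  show ?case
  proof (cases "xs = []")
    case False
    then have "alt_path E C f xs" "alt_arc E C f (last xs) x"
      using snoc.prems(1) by (auto simp: alt_path_def successively_append_iff)
    then show ?thesis using snoc assms(1) False by (auto simp: alt_arc_def alt_closed_def)
  qed (use snoc in auto)
qed (simp add: alt_path_def)

lemma alt_ball_step:
  assumes "x \<in> alt_ball E C f k i" "c \<in> C" "{x, c} \<in> E"
  shows "f c \<in> alt_ball E C f (Suc k) i"
proof -
  obtain xs where xs: "alt_path E C f xs" "hd xs = i" "length xs \<le> Suc k" "x = last xs"
    using assms(1) by (auto simp: alt_ball_def)
  obtain ys where "alt_path E C f ys" "hd ys = hd xs" "last ys = f c" "length ys \<le> Suc (length xs)"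
    using alt_path_extend[OF xs(1) assms(2)] assms(3) xs(4) by metis
  then show ?thesis unfolding alt_ball_def using xs by (auto intro!: exI[of _ ys])
qed

lemma alt_ball_mono: "alt_ball E C f k i \<subseteq> alt_ball E C f (Suc k) i"
  by (force simp: alt_ball_def)

lemma alt_ball_self: "i \<in> alt_ball E C f k i"
  unfolding alt_ball_def by (force intro: exI[of _ "[i]"] alt_path_singleton)

lemma alt_ball_subset_reach: "alt_ball E C f k i \<subseteq> alt_reach E C f {} i"
  by (auto simp: alt_ball_def alt_reach_def)

text \<open>A ball that is not closed gains a vertex at the next radius, while a closed one stays
  the same for ever.\<close>

lemma alt_ball_closed_or_large:
  assumes "finite C"
  shows "alt_closed E C f {} (alt_ball E C f k i) \<or> Suc k \<le> card (alt_ball E C f k i)"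
proof (induction k)
  case 0
  have "finite (alt_ball E C f 0 i)"
    by (rule finite_subset[OF subset_trans[OF alt_ball_subset_reach alt_reach_subset]])
      (use assms in auto)
  then have "card (alt_ball E C f 0 i) > 0" using alt_ball_self[of i E C f 0] by (auto simp: card_gt_0_iff)
  then show ?case by simp
next
  case (Suc k)
  have fin: "finite (alt_ball E C f (Suc k) i)"
    by (rule finite_subset[OF subset_trans[OF alt_ball_subset_reach alt_reach_subset]])
      (use assms in auto)
  show ?case
  proof (cases "alt_closed E C f {} (alt_ball E C f k i)")
    case True
    then have "alt_ball E C f (Suc k) i \<subseteq> alt_ball E C f k i"
      using alt_path_last_in_closed[OF True] alt_ball_self[of i E C f k] by (auto simp: alt_ball_def)
    then have "alt_ball E C f (Suc k) i = alt_ball E C f k i" using alt_ball_mono by (metis subset_antisym)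
    then show ?thesis using True by simp
  next
    case False
    then obtain x c where xc: "x \<in> alt_ball E C f k i" "c \<in> C" "{x, c} \<in> E" "f c \<notin> alt_ball E C f k i"
      by (auto simp: alt_closed_def)
    then have "f c \<in> alt_ball E C f (Suc k) i" using alt_ball_step by metis
    then have "alt_ball E C f k i \<subset> alt_ball E C f (Suc k) i" using xc(4) alt_ball_mono[of E C f k i] by blast
    then have "card (alt_ball E C f k i) < card (alt_ball E C f (Suc k) i)"
      using fin psubset_card_mono by metis
    then show ?thesis using Suc False by auto
  qed
qed

lemma konig_pair_card:
  assumes "finite V" "konig_pair V E C f"
  shows "2 * card C \<le> card V"
proof -
  have C: "C \<subseteq> V" "inj_on f C" "f ` C \<subseteq> V - C" using assms(2) by (auto simp: konig_pair_def)
  then have "card C \<le> card (V - C)"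
    using assms(1) by (metis card_image card_mono finite_Diff)
  moreover have "card (V - C) = card V - card C" "card C \<le> card V"
    using C(1) assms(1) by (auto simp: card_Diff_subset card_mono finite_subset)
  ultimately show ?thesis by linarith
qed

text \<open>The late phase: \<open>C\<close> and its complement each have about half of the
  vertices, and at most \<open>n / 1000\<close> vertices are missed by the matching.\<close>

locale konig_expander =
  fixes V :: "'a set" and E :: "'a set set" and C :: "'a set" and f :: "'a \<Rightarrow> 'a"
  assumes finV: "finite V" and EV: "E \<subseteq> nsets V 2" and pair: "konig_pair V E C f"
    and exp: "expander V E"
    and small_def: "999 * card V \<le> 2000 * card C"
    and large: "1000000 \<le> card V"
begin

abbreviation W :: "'a set" where "W \<equiv> V - C - f ` C"

lemma CV: "C \<subseteq> V" and inj: "inj_on f C" and fC: "f ` C \<subseteq> V - C"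
  and cover: "e \<in> E \<Longrightarrow> e \<inter> C \<noteq> {}" and edge: "c \<in> C \<Longrightarrow> {c, f c} \<in> E"
  using pair by (auto simp: konig_pair_def)

lemma finC: "finite C" using CV finV finite_subset by auto

lemma finE: "finite E" using finite_edges[OF finV EV] .

lemma card_VC: "card (V - C) = card V - card C" and card_CV: "card C \<le> card V"
  using CV finC finV by (auto simp: card_Diff_subset card_mono)

lemma card_fC: "card (f ` C) = card C" using card_image[OF inj] .

lemma card_C: "2 * card C \<le> card V"
  by (rule konig_pair_card[OF finV pair])

lemma card_W: "card W + 2 * card C = card V"
proof -
  have "card W = card (V - C) - card (f ` C)"
    by (rule card_Diff_subset) (use fC finC in auto)
  then show ?thesis using card_VC card_C card_fC by linarith
qed

lemma nu: "matching_number E = card C" and tau: "cover_number V E = card C"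
  and konig: "konig_graph V E"
  using konig_pairD[OF finV EV pair] by auto

text \<open>The alternative \<open>e \<subseteq> I\<close> of \<open>expander\<close> is impossible
  for \<open>I = V - C\<close>, since every edge meets the cover.\<close>

lemma edge_between:
  assumes "S \<subseteq> V" "T \<subseteq> C" "S \<inter> T = {}" "card V \<le> 50 * card S" "card V \<le> 50 * card T"
  shows "\<exists>s\<in>S. \<exists>t\<in>T. {s, t} \<in> E"
proof -
  have "T \<subseteq> V" "T \<inter> (V - C) = {}" using assms CV by auto
  moreover have "card V \<le> 2 * card (V - C)" using card_VC card_C by linarith
  ultimately obtain e where "e \<in> E" "e \<subseteq> V - C \<or> (\<exists>s\<in>S. \<exists>t\<in>T. e = {s, t})"
    using exp assms unfolding expander_def by (metis Diff_subset)
  then show ?thesis using cover[of e] by blast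
qed

text \<open>An edge from \<open>S\<close> to a cover vertex whose partner lies outside
  \<open>S \<union> Z\<close> would contradict closedness, so expansion limits the number of such
  cover vertices.\<close>

lemma closed_complement_small:
  assumes "alt_closed E C f Z S" "S \<subseteq> V - C" "card V \<le> 50 * card S"
  shows "50 * card {c \<in> C. f c \<notin> S \<union> Z} < card V"
proof (rule ccontr)
  assume "\<not> ?thesis"
  then obtain s t where "s \<in> S" "t \<in> {c \<in> C. f c \<notin> S \<union> Z}" "{s, t} \<in> E"
    using edge_between[of S "{c \<in> C. f c \<notin> S \<union> Z}"] assms by fastforce
  then show False using assms(1) by (auto simp: alt_closed_def)
qed

lemma card_preimage_le: "finite S \<Longrightarrow> card {c \<in> C. f c \<in> S} \<le> card S"
  by (rule card_inj_on_le[of f]) (use inj in \<open>auto intro: inj_on_subset\<close>)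

lemma closed_large:
  assumes "alt_closed E C f Z S" "S \<subseteq> V - C" "card V \<le> 50 * card S" "finite Z"
  shows "50 * card C < card V + 50 * card S + 50 * card Z"
proof -
  have finS: "finite S" using assms(2) finV finite_subset by auto
  have "C = {c \<in> C. f c \<notin> S \<union> Z} \<union> {c \<in> C. f c \<in> S \<union> Z}" by auto
  then have "card C \<le> card {c \<in> C. f c \<notin> S \<union> Z} + card {c \<in> C. f c \<in> S \<union> Z}"
    by (metis (no_types, lifting) card_Un_le)
  also have "card {c \<in> C. f c \<in> S \<union> Z} \<le> card (S \<union> Z)"
    using card_preimage_le finS assms(4) by blast
  also have "card (S \<union> Z) \<le> card S + card Z" by (rule card_Un_le)
  finally show ?thesis using closed_complement_small[OF assms(1-3)] by linarith
qed

text \<open>The source of the dichotomy. A closed set with at least \<open>n / 50\<close> elements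
  has more than \<open>2 n / 50\<close>: by \<open>closed_large\<close> it misses fewer than
  \<open>n / 50 + card Z\<close>, at most \<open>21 n / 50\<close>, of the at least
  \<open>24.975 n / 50\<close> partners. Unions of closed sets are closed, so
  \<open>card_Union_less\<close> applies.\<close>

lemma Union_closed_small:
  assumes "finite \<A>" "finite Z" "50 * card Z \<le> 20 * card V"
    and "\<And>S. S \<in> \<A> \<Longrightarrow> alt_closed E C f Z S \<and> S \<subseteq> V - C \<and> 50 * card S < card V"
  shows "50 * card (\<Union>\<A>) < card V"
proof (rule card_Union_less)
  fix \<B> assume B: "\<B> \<subseteq> \<A>"
  show "\<not> (card V \<le> 50 * card (\<Union>\<B>) \<and> 50 * card (\<Union>\<B>) < 2 * card V)"
  proof
    assume *: "card V \<le> 50 * card (\<Union>\<B>) \<and> 50 * card (\<Union>\<B>) < 2 * card V"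
    have "50 * card C < card V + 50 * card (\<Union>\<B>) + 50 * card Z"
      by (rule closed_large) (use B assms * in \<open>auto intro!: alt_closed_Union\<close>)
    then show False using * assms(3) small_def large by linarith
  qed
qed (use assms large in auto)

section \<open>Minimum covers other than \<open>C\<close>, given by what they omit from
  \<open>C\<close>\<close>

definition alternative_covers :: "'a set set" where
  "alternative_covers = {C - C' |C'. vertex_cover V E C' \<and> card C' = card C}"

lemma alternative_covers_subset: "T \<in> alternative_covers \<Longrightarrow> T \<subseteq> C"
  by (auto simp: alternative_covers_def)

text \<open>Omitting \<open>c\<close> forces \<open>f c\<close> into the cover because of the edge
  \<open>{c, f c}\<close>, and equal sizes leave no room for any other vertex.\<close>

lemma alternative_cover_image:
  assumes C': "vertex_cover V E C'" "card C' = card C"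
  shows "C' - C = f ` (C - C')"
proof -
  have fin: "finite C'" using C' finV by (auto simp: vertex_cover_def finite_subset)
  have sub: "f ` (C - C') \<subseteq> C' - C"
  proof
    fix x assume "x \<in> f ` (C - C')"
    then obtain c where c: "c \<in> C" "c \<notin> C'" "x = f c" by auto
    then have "\<exists>v\<in>C'. v \<in> {c, f c}" using C' edge[OF c(1)] unfolding vertex_cover_def by blast
    then show "x \<in> C' - C" using c fC by auto
  qed
  have "card (f ` (C - C')) = card (C - C')"
    by (rule card_image) (use inj in \<open>auto intro: inj_on_subset\<close>)
  moreover have "card (C - C') = card (C' - C)"
    using C'(2) fin finC by (simp add: card_Diff_subset_Int Int_commute)
  ultimately show ?thesis using sub fin by (metis card_subset_eq finite_Diff)
qed

lemma alternative_cover_neighbours: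
  assumes "T \<in> alternative_covers" "c \<in> T" "x \<in> V - C" "{x, c} \<in> E"
  shows "x \<in> f ` T"
proof -
  obtain C' where C': "vertex_cover V E C'" "card C' = card C" "T = C - C'"
    using assms(1) by (auto simp: alternative_covers_def)
  have "\<exists>v\<in>C'. v \<in> {x, c}" using C'(1) assms(4) unfolding vertex_cover_def by blast
  then have "x \<in> C' - C" using assms C'(3) by auto
  then show ?thesis using alternative_cover_image[OF C'(1,2)] C'(3) by simp
qed

text \<open>\<open>T\<close> is disjoint from another cover, hence contains no edge. But the halves
  of a \<open>T\<close> of size \<open>n / 20\<close> would have \<open>n / 50\<close> vertices
  each, and expansion would give an edge between them.\<close>

lemma alternative_cover_small:
  assumes "T \<in> alternative_covers"
  shows "20 * card T < card V"
proof (rule ccontr)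
  assume "\<not> ?thesis"
  then have T: "card V \<le> 20 * card T" by simp
  obtain C' where C': "vertex_cover V E C'" "T = C - C'"
    using assms by (auto simp: alternative_covers_def)
  have finT: "finite T" using C' finC by simp
  let ?k = "card T div 2"
  obtain S where S: "S \<subseteq> T" "card S = ?k" using obtain_subset_with_card_n[of ?k T] by auto
  have "card (T - S) = card T - ?k" using S finT by (simp add: card_Diff_subset finite_subset)
  then have "card V \<le> 50 * card S" "card V \<le> 50 * card (T - S)"
    using T S(2) large by linarith+
  moreover have "S \<subseteq> V" "T - S \<subseteq> C" "S \<inter> (T - S) = {}" using S C' CV by auto
  ultimately obtain s t where "s \<in> S" "t \<in> T - S" "{s, t} \<in> E" using edge_between by blast
  moreover from this have "\<exists>v\<in>C'. v \<in> {s, t}" using C'(1) unfolding vertex_cover_def by blast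
  ultimately show False using S C'(2) by auto
qed

text \<open>Again an excluded window. A vertex outside \<open>C\<close> and outside the
  \<open>f\<close>-image of the union has no edge to the union; for a union of size between
  \<open>n / 20\<close> and \<open>n / 10\<close>, both sets would be large enough for
  expansion.\<close>

lemma Union_alternative_covers_small: "20 * card (\<Union>alternative_covers) < card V"
proof (rule card_Union_less)
  show "finite alternative_covers"
    by (rule finite_subset[of _ "Pow C"]) (use alternative_covers_subset finC in auto)
  fix \<B> assume B: "\<B> \<subseteq> alternative_covers"
  let ?Y = "\<Union>\<B>"
  show "\<not> (card V \<le> 20 * card ?Y \<and> 20 * card ?Y < 2 * card V)"
  proof
    assume *: "card V \<le> 20 * card ?Y \<and> 20 * card ?Y < 2 * card V"
    have Y: "?Y \<subseteq> C" using B alternative_covers_subset by blast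
    let ?S = "V - C - f ` ?Y"
    have "card ?S \<ge> card (V - C) - card (f ` ?Y)"
      by (rule diff_card_le_card_Diff) (use Y finC finite_subset in blast)
    moreover have "card (f ` ?Y) = card ?Y" by (rule card_image) (use inj Y inj_on_subset in blast)
    ultimately have "card V \<le> 50 * card ?S" using * card_VC card_C by linarith
    moreover have "card V \<le> 50 * card ?Y" using * by linarith
    ultimately obtain s t where st: "s \<in> ?S" "t \<in> ?Y" "{s, t} \<in> E"
      using edge_between[of ?S ?Y] Y by blast
    then obtain T where "T \<in> \<B>" "t \<in> T" by auto
    then have "s \<in> f ` T" using alternative_cover_neighbours[of T t s] B st by blast
    then show False using st(1) \<open>T \<in> \<B>\<close> by auto
  qed
qed (use large alternative_cover_small in auto)

section \<open>Vertices missed by maximum matchings, and pairs accepted at isolated vertices\<close>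

definition reached :: "'a set" where
  "reached = (\<Union>w\<in>W. alt_reach E C f {} w)"

lemma reached_closed: "alt_closed E C f {} reached"
  unfolding reached_def by (intro alt_closed_Union) (auto intro: alt_reach_closed)

lemma W_reached: "W \<subseteq> reached"
  unfolding reached_def by (force intro: alt_reach_self)

lemma alt_reach_VC: "i \<in> V - C \<Longrightarrow> alt_reach E C f Z i \<subseteq> V - C"
  using alt_reach_subset[of E C f Z i] fC by auto

lemma reached_subset: "reached \<subseteq> V - C"
  unfolding reached_def using alt_reach_VC by blast

text \<open>If \<open>f c\<close> is not reached, neither is \<open>g c\<close>, since an edge from
  a reached vertex to \<open>c\<close> would make \<open>f c\<close> reached. By counting,
  \<open>f\<close> and \<open>g\<close> use the same unreached vertices, so \<open>g\<close> misses
  none of them.\<close>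

lemma missed_reached:
  assumes g: "konig_pair V E C g" and u: "u \<in> V - C" "u \<notin> g ` C"
  shows "u \<in> reached"
proof (rule ccontr)
  assume nu: "u \<notin> reached"
  define B where "B = {c \<in> C. f c \<notin> reached}"
  have gB: "g ` B \<subseteq> f ` B"
  proof
    fix x assume "x \<in> g ` B"
    then obtain c where c: "c \<in> C" "f c \<notin> reached" "x = g c" by (auto simp: B_def)
    then have x: "x \<in> V - C" "{x, c} \<in> E" using g by (auto simp: konig_pair_def insert_commute)
    then have "x \<notin> reached" using reached_closed c by (auto simp: alt_closed_def)
    then have "x \<in> f ` C" using x W_reached by auto
    then show "x \<in> f ` B" using \<open>x \<notin> reached\<close> by (auto simp: B_def)
  qed
  have "B \<subseteq> C" by (auto simp: B_def)
  then have "inj_on g B" "inj_on f B" "finite B"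
    using g inj finC inj_on_subset finite_subset by (auto simp: konig_pair_def)
  then have "g ` B = f ` B" using gB by (metis card_image card_subset_eq finite_imageI)
  moreover have "u \<in> f ` B" using u nu W_reached by (auto simp: B_def)
  ultimately show False using u(2) \<open>B \<subseteq> C\<close> by auto
qed

text \<open>Acceptance leaves two possibilities. If the matching number is unchanged, a minimum
  cover of the new graph is also one of the old graph; it cannot contain the isolated
  \<open>v\<close>, so it contains \<open>u\<close>. Otherwise a new maximum matching uses
  \<open>{v, u}\<close>, and without that edge it is a maximum matching of \<open>E\<close> that
  misses \<open>u\<close>.\<close>

lemma isolated_accepted:
  assumes v: "isolated_vertex V E v" and u: "u \<in> V - C" "u \<noteq> v"
    and acc: "konig_graph V (insert {v, u} E)"
  shows "u \<in> f ` (\<Union>alternative_covers) \<union> reached"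
proof (cases "matching_number (insert {v, u} E) = matching_number E")
  case True
  have vV: "v \<in> V" and vE: "\<And>e. e \<in> E \<Longrightarrow> v \<notin> e" using v by (auto simp: isolated_vertex_def)
  have sub: "insert {v, u} E \<subseteq> nsets V 2" using EV u vV by (auto simp: doubleton_in_nsets_2)
  obtain C' where C': "vertex_cover V (insert {v, u} E) C'" "card C' = card C"
    using minimum_cover_exists[OF finV sub] acc True nu unfolding konig_graph_def by metis
  have cov: "vertex_cover V E C'" using C' by (auto simp: vertex_cover_def)
  have finC': "finite C'" using C' finV by (auto simp: vertex_cover_def finite_subset)
  have "v \<notin> C'"
  proof
    assume vC: "v \<in> C'"
    have "vertex_cover V E (C' - {v})"
      using cov vE unfolding vertex_cover_def by (metis Diff_iff insert_iff empty_iff subset_iff)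
    then have "card C \<le> card (C' - {v})" using cover_number_le[OF finV] tau by metis
    then show False using vC C'(2) finC' by (metis card_Diff1_less leD)
  qed
  then have "u \<in> C' - C" using C'(1) u by (auto simp: vertex_cover_def)
  then have "u \<in> f ` (C - C')" using alternative_cover_image[OF cov C'(2)] by simp
  moreover have "C - C' \<in> alternative_covers" using cov C'(2) by (auto simp: alternative_covers_def)
  ultimately show ?thesis by blast
next
  case False
  have vE: "\<And>e. e \<in> E \<Longrightarrow> v \<notin> e" using v by (auto simp: isolated_vertex_def)
  have "matching_number (insert {v, u} E) = Suc (card C)"
    using matching_number_insert_le[OF finE] matching_number_mono[of "insert {v, u} E" E] finE False nu
    by (metis finite_insert le_SucE le_antisym subset_insertI)
  then obtain M where M: "matching (insert {v, u} E) M" "card M = Suc (card C)"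
    using maximum_matching_exists finE by (metis finite_insert)
  define M' where "M' = M - {{v, u}}"
  have M': "matching E M'" using M by (auto simp: matching_def M'_def disjoint_def)
  then have "card M' \<le> card C" using card_le_matching_number[OF finE M'] nu by simp
  moreover have vuM: "{v, u} \<in> M"
    using M M' card_le_matching_number[OF finE M'] nu by (cases "{v, u} \<in> M") (auto simp: M'_def)
  ultimately have "card M' = matching_number E"
    using M(2) nu by (simp add: M'_def)
  then obtain g where g: "konig_pair V E C g" "\<And>c. c \<in> C \<Longrightarrow> {c, g c} \<in> M'"
    using konig_pair_exists[OF finV EV konig_pair_cover[OF pair] nu[symmetric] M'] by metis
  have "u \<notin> g ` C"
  proof
    assume "u \<in> g ` C"
    then obtain c where c: "c \<in> C" "u = g c" by auto
    then have m: "{c, u} \<in> M'" using g(2)[OF c(1)] by simp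
    then have "{c, u} \<in> M" "{c, u} \<noteq> {v, u}" by (auto simp: M'_def)
    moreover have "disjoint M" using M(1) by (simp add: matching_def)
    ultimately have "{c, u} \<inter> {v, u} = {}" using vuM disjointD by metis
    then show False by auto
  qed
  then show ?thesis using missed_reached[OF g(1)] u by auto
qed

text \<open>At most \<open>n / 2\<close> vertices in \<open>C\<close>, \<open>n / 20\<close> from
  other covers and \<open>n / 50\<close> reached ones add up to 57 per cent.\<close>

lemma isolated_accepted_few:
  assumes v: "isolated_vertex V E v" and few: "50 * card reached < card V"
  shows "100 * card {u. {v, u} \<in> nsets V 2 \<and> konig_graph V (insert {v, u} E)} \<le> 57 * card V"
proof -
  let ?U = "{u. {v, u} \<in> nsets V 2 \<and> konig_graph V (insert {v, u} E)}"
  have T: "\<Union>alternative_covers \<subseteq> C" using alternative_covers_subset by blast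
  then have finT: "finite (\<Union>alternative_covers)" using finC finite_subset by blast
  have finR: "finite reached" using reached_subset finV finite_subset by blast
  have "?U \<subseteq> C \<union> (f ` (\<Union>alternative_covers) \<union> reached)"
  proof
    fix u assume u: "u \<in> ?U"
    then have "u \<in> V" "u \<noteq> v" by (auto simp: doubleton_in_nsets_2)
    then show "u \<in> C \<union> (f ` (\<Union>alternative_covers) \<union> reached)"
      using isolated_accepted[OF v, of u] u by blast
  qed
  then have "card ?U \<le> card (C \<union> (f ` (\<Union>alternative_covers) \<union> reached))"
    using finC finT finR by (intro card_mono) auto
  also have "\<dots> \<le> card C + card (f ` (\<Union>alternative_covers) \<union> reached)" by (rule card_Un_le)
  also have "card (f ` (\<Union>alternative_covers) \<union> reached) \<le>
      card (f ` (\<Union>alternative_covers)) + card reached" by (rule card_Un_le)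
  also have "card (f ` (\<Union>alternative_covers)) \<le> card (\<Union>alternative_covers)"
    by (rule card_image_le[OF finT])
  finally have "card ?U \<le> card C + card (\<Union>alternative_covers) + card reached" by simp
  then show ?thesis using card_C Union_alternative_covers_small few by linarith
qed

end

section \<open>Augmenting and progress pairs when many vertices are reached\<close>

context konig_expander
begin

lemma alt_reach_W: "w \<in> W \<Longrightarrow> alt_reach E C f Z w \<subseteq> V - C"
  by (rule alt_reach_VC) simp

lemma alt_ball_W: "w \<in> W \<Longrightarrow> alt_ball E C f k w \<subseteq> V - C"
  by (rule subset_trans[OF alt_ball_subset_reach alt_reach_W])

lemma alt_path_last_VC:
  assumes "alt_path E C f xs" "hd xs \<in> V - C"
  shows "last xs \<in> V - C"
proof -
  have "last xs \<in> insert (hd xs) (f ` C)"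
    using alt_path_set[OF assms(1)] alt_path_last_mem[OF assms(1)] by (rule subsetD)
  then show ?thesis using assms(2) fC by (metis insert_iff subsetD)
qed

text \<open>If every single source reached few vertices, \<open>Union_closed_small\<close> would
  make the whole union small.\<close>

lemma reached_large_source:
  assumes "card V \<le> 50 * card reached"
  obtains w where "w \<in> W" "card V \<le> 50 * card (alt_reach E C f {} w)"
proof (rule ccontr)
  assume neg: "\<not> thesis"
  have "50 * card (\<Union>(alt_reach E C f {} ` W)) < card V"
  proof (rule Union_closed_small)
    fix S assume "S \<in> alt_reach E C f {} ` W"
    then obtain w where w: "w \<in> W" "S = alt_reach E C f {} w" by auto
    then show "alt_closed E C f {} S \<and> S \<subseteq> V - C \<and> 50 * card S < card V"
      using neg that alt_reach_closed alt_reach_W[of w] by (metis leI)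
  qed (use finV in auto)
  then show False using assms by (simp add: reached_def)
qed

text \<open>Small enough that deleting a path inside the ball is harmless: it has at most
  \<open>n / 50 + 3\<close> vertices. One unit is reserved for the last expansion step in
  \<open>ball_large\<close>.\<close>

definition ball_radius :: nat where "ball_radius = card V div 50 + 2"

text \<open>The ball of radius \<open>ball_radius - 1\<close> has at least \<open>n / 50\<close>
  vertices, being either everything reachable or larger than its radius. By expansion, one more step
  then reaches almost all partners.\<close>

lemma ball_large:
  assumes w: "w \<in> W" "card V \<le> 50 * card (alt_reach E C f {} w)"
  shows "50 * card C < card V + 50 * card (alt_ball E C f ball_radius w)"
proof -
  define k where "k = card V div 50 + 1"
  have k: "ball_radius = Suc k" by (simp add: ball_radius_def k_def)
  let ?B = "alt_ball E C f k w" and ?X = "alt_ball E C f (Suc k) w"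
  have sub: "alt_ball E C f j w \<subseteq> V - C" for j
    by (rule alt_ball_W[OF w(1)])
  have fin: "finite (alt_ball E C f j w)" for j using sub[of j] finV finite_subset by blast
  have B: "card V \<le> 50 * card ?B"
  proof (cases "alt_closed E C f {} ?B")
    case True
    then have "alt_reach E C f {} w \<subseteq> ?B"
      using alt_path_last_in_closed[OF True] alt_ball_self[of w E C f k] by (auto simp: alt_reach_def)
    then have "card (alt_reach E C f {} w) \<le> card ?B" using fin card_mono by blast
    then show ?thesis using w(2) by linarith
  next
    case False
    then have "Suc k \<le> card ?B" using alt_ball_closed_or_large[OF finC] by blast
    then show ?thesis unfolding k_def by linarith
  qed
  let ?T = "{c \<in> C. f c \<notin> ?X}"
  have "50 * card ?T < card V"
  proof (rule ccontr)
    assume "\<not> ?thesis"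
    then obtain s t where st: "s \<in> ?B" "t \<in> ?T" "{s, t} \<in> E"
      using edge_between[of ?B ?T] B sub[of k] by fastforce
    then show False using alt_ball_step[of s E C f k w t] by auto
  qed
  moreover have "card C \<le> card ?T + card {c \<in> C. f c \<in> ?X}"
  proof -
    have "C = ?T \<union> {c \<in> C. f c \<in> ?X}" by auto
    then show ?thesis by (metis (no_types, lifting) card_Un_le)
  qed
  moreover have "card {c \<in> C. f c \<in> ?X} \<le> card ?X" using card_preimage_le fin by blast
  ultimately show ?thesis unfolding k by linarith
qed

text \<open>Swapping along a path from \<open>w\<close> to \<open>x\<close> makes \<open>x\<close>
  missed and leaves \<open>v\<close> missed.\<close>

lemma augmenting_from_reach:
  assumes w: "w \<in> W" "v \<in> W" "v \<noteq> w" and x: "x \<in> alt_reach E C f {} w"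
  shows "{v, x} \<in> augmenting_pairs V E"
proof -
  obtain xs where xs: "alt_path E C f xs" "hd xs = w" "last xs = x"
    using x by (auto simp: alt_reach_def)
  obtain g where g: "konig_pair V E C g" "g ` C \<subseteq> insert (hd xs) (f ` C) - {last xs}"
    using alt_path_swap[OF pair xs(1)] w(1) xs(2) by metis
  have x': "x \<in> V - C" using x alt_reach_W[OF w(1)] by auto
  have vx: "v \<noteq> x"
    using alt_path_set[OF xs(1)] alt_path_last_mem[OF xs(1)] xs w by auto
  have "x \<in> V - C - g ` C" "v \<in> V - C - g ` C" using g(2) xs x' w by auto
  then have "matching_number E < matching_number (insert {v, x} E)"
    using matching_number_augment[OF finV EV g(1)] vx by blast
  then show ?thesis
    using x' w vx by (simp add: augmenting_pairs_def doubleton_in_nsets_2)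
qed

text \<open>Rematching \<open>c\<close> to \<open>v\<close> frees \<open>f c\<close>, so
  \<open>w\<close> and \<open>f c\<close> are both missed. Swapping along disjoint paths from them
  moves the missed vertices to \<open>last xs\<close> and \<open>last ys\<close>, which the second
  pair joins.\<close>

lemma augmenting_two_paths:
  assumes w: "w \<in> W" "v \<in> W" "v \<noteq> w" and c: "c \<in> C"
    and xs: "alt_path E C f xs" "hd xs = w" "f c \<notin> set xs"
    and ys: "alt_path E C f ys" "hd ys = f c" "set ys \<inter> set xs = {}"
  shows "{last xs, last ys} \<in> augmenting_pairs V (insert {v, c} E)"
proof -
  let ?E = "insert {v, c} E" and ?f = "f(c := v)"
  have v: "v \<in> V" "v \<notin> C" "v \<notin> f ` C" and w': "w \<in> V" "w \<notin> C" "w \<notin> f ` C" using w by auto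
  have EV': "?E \<subseteq> nsets V 2" using EV v c CV by (auto simp: doubleton_in_nsets_2)
  have fpair: "konig_pair V ?E C ?f"
    using pair v c inj by (auto simp: konig_pair_def inj_on_def insert_commute)
  have fimg: "?f ` C \<subseteq> insert v (f ` C) - {f c}" using inj c v by (auto simp: inj_on_def)
  have other: "(?f) d = f d" if "f d \<noteq> f c" for d using that by auto
  have lx: "last xs \<in> V - C" "last xs \<in> set xs"
    using alt_path_last_VC[OF xs(1)] alt_path_last_mem[OF xs(1)] xs(2) w(1) by auto
  have fcVC: "f c \<in> V - C" using fC c by auto
  have ly: "last ys \<in> V - C" "last ys \<in> set ys"
    using alt_path_last_VC[OF ys(1)] alt_path_last_mem[OF ys(1)] ys(2) fcVC by auto
  have "alt_path ?E C ?f xs"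
  proof (rule alt_path_cong[OF xs(1)])
    fix d assume "d \<in> C" "f d \<in> set (tl xs)"
    then have "f d \<in> set xs" by (cases xs) auto
    then show "(?f) d = f d" using xs(3) by (intro other) auto
  qed auto
  moreover have "hd xs \<in> V - C - ?f ` C" using fimg xs(2) w' w(3) by auto
  ultimately obtain g where g: "konig_pair V ?E C g" "g ` C \<subseteq> insert (hd xs) (?f ` C) - {last xs}"
    "\<And>d. d \<in> C \<Longrightarrow> (?f) d \<notin> set xs \<Longrightarrow> g d = (?f) d"
    using alt_path_swap[OF fpair] by metis
  have "alt_path ?E C g ys"
  proof (rule alt_path_cong[OF ys(1)])
    fix d assume d: "d \<in> C" "f d \<in> set (tl ys)"
    then have dy: "f d \<in> set ys" by (cases ys) auto
    have "distinct ys" "ys \<noteq> []" using ys(1) by (auto simp: alt_path_def)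
    \<comment> \<open>\<open>f c\<close> occurs only as the head of \<open>ys\<close>, so the
      changed partner of \<open>c\<close> does not affect this path.\<close>
    then have "hd ys \<notin> set (tl ys)" by (cases ys) auto
    then have fd: "(?f) d = f d" using d(2) ys(2) by (intro other) auto
    have "f d \<notin> set xs" using dy ys(3) by blast
    then show "g d = f d" using g(3)[OF d(1)] fd by simp
  qed auto
  moreover have gimg: "g ` C \<subseteq> insert w (insert v (f ` C) - {f c}) - {last xs}"
    using order_trans[OF g(2) Diff_mono[OF Set.insert_mono[OF fimg] subset_refl]] unfolding xs(2) .
  have "f c \<noteq> w" using w'(3) c by auto
  then have "f c \<notin> g ` C" using subsetD[OF gimg, of "f c"] by blast
  then have "hd ys \<in> V - C - g ` C" using ys(2) fcVC by (metis DiffI)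
  ultimately obtain h where h: "konig_pair V ?E C h" "h ` C \<subseteq> insert (hd ys) (g ` C) - {last ys}"
    using alt_path_swap[OF g(1)] by metis
  have "last xs \<noteq> f c" using lx(2) xs(3) by metis
  moreover have "last xs \<notin> g ` C" using gimg by blast
  ultimately have "last xs \<notin> h ` C" using subsetD[OF h(2), of "last xs"] unfolding ys(2) by blast
  moreover have "last ys \<notin> h ` C" using h(2) by blast
  moreover have ne: "last xs \<noteq> last ys" using lx(2) ly(2) ys(3) by (metis IntI empty_iff)
  ultimately have "matching_number ?E < matching_number (insert {last xs, last ys} ?E)"
    using matching_number_augment[OF finV EV' h(1), of "last xs" "last ys"] lx(1) ly(1) by (metis DiffI)
  moreover have "last xs \<in> V" "last ys \<in> V" using lx(1) ly(1) by blast+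
  ultimately show ?thesis using ne by (simp add: augmenting_pairs_def doubleton_in_nsets_2)
qed

text \<open>Each such \<open>d\<close> lies in its own reachable set, so their number is at most the
  size of a union of small closed sets.\<close>

lemma few_short_reach:
  assumes "finite Z" "50 * card Z \<le> 20 * card V"
  shows "50 * card {d \<in> V - C - Z. 50 * card (alt_reach E C f Z d) < card V} < card V"
proof -
  let ?D = "{d \<in> V - C - Z. 50 * card (alt_reach E C f Z d) < card V}"
  have "50 * card (\<Union>(alt_reach E C f Z ` ?D)) < card V"
  proof (rule Union_closed_small[OF _ assms])
    fix S assume "S \<in> alt_reach E C f Z ` ?D"
    then obtain d where d: "d \<in> ?D" "S = alt_reach E C f Z d" by blast
    then have "d \<in> V - C" "50 * card S < card V" by auto
    then show "alt_closed E C f Z S \<and> S \<subseteq> V - C \<and> 50 * card S < card V"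
      unfolding d(2) using alt_reach_closed alt_reach_VC by metis
  qed (use finV in auto)
  moreover have "?D \<subseteq> \<Union>(alt_reach E C f Z ` ?D)"
    by (auto intro: alt_reach_self)
  moreover have "finite (\<Union>(alt_reach E C f Z ` ?D))"
    by (rule finite_subset[of _ V], rule UN_least, rule order_trans[OF alt_reach_VC])
      (auto simp: finV)
  ultimately show ?thesis using card_mono by (meson le_less_trans mult_le_mono2)
qed

text \<open>
  Deleting a short path from \<open>w\<close> to \<open>x\<close> destroys the expansion only for few sources \<open>f c\<close>, so for most
  \<open>c\<close> there are disjoint alternating paths from \<open>w\<close> to \<open>x\<close> and from \<open>f c\<close> to most \<open>y\<close>. This is why
  only vertices \<open>x\<close> in a ball of bounded radius are considered.
\<close>

lemma neighbours_after_insert: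
  assumes w: "w \<in> W" "v \<in> W" "v \<noteq> w"
    and B: "B \<subseteq> C" "card V < 10 * card B"
    and x: "x \<in> alt_ball E C f ball_radius w"
  shows "22 * card V * card B \<le>
    100 * (\<Sum>c\<in>B. card (neighbours (augmenting_pairs V (insert {v, c} E)) x))"
proof -
  let ?n = "card V" and ?N = "\<lambda>c. neighbours (augmenting_pairs V (insert {v, c} E)) x"
  obtain xs where xs: "alt_path E C f xs" "hd xs = w" "last xs = x" "length xs \<le> Suc ball_radius"
    using x by (auto simp: alt_ball_def)
  let ?Z = "set xs"
  have Z: "50 * card ?Z \<le> ?n + 150"
    using card_length[of xs] xs(4) unfolding ball_radius_def by linarith
  let ?D = "{d \<in> V - C - ?Z. 50 * card (alt_reach E C f ?Z d) < ?n}"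
  have D: "50 * card ?D < ?n" by (rule few_short_reach) (use Z large in auto)
  have finB: "finite B" using B finC finite_subset by auto
  let ?G = "{c \<in> B. f c \<notin> ?Z \<union> ?D}"
  have finN: "finite (?N c)" for c
    by (rule finite_subset[of _ V]) (auto simp: finV neighbours_def augmenting_pairs_def doubleton_in_nsets_2)
  \<comment> \<open>In units of 1/50: at least \<open>24.975 n\<close> partners, less
    \<open>n\<close> for the expansion and \<open>n + 150\<close> for the deleted path, leave more
    than \<open>22 n\<close>.\<close>
  have big: "22 * ?n \<le> 50 * card (?N c)" if c: "c \<in> ?G" for c
  proof -
    have cC: "c \<in> C" using c B by auto
    have fc: "f c \<in> V - C" "f c \<notin> ?Z" using c fC cC by auto
    then have "?n \<le> 50 * card (alt_reach E C f ?Z (f c))" using c by auto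
    then have "50 * card C < ?n + 50 * card (alt_reach E C f ?Z (f c)) + 50 * card ?Z"
      using alt_reach_VC[OF fc(1)] by (intro closed_large alt_reach_closed) auto
    moreover have "alt_reach E C f ?Z (f c) \<subseteq> ?N c"
    proof
      fix y assume "y \<in> alt_reach E C f ?Z (f c)"
      then obtain ys where ys: "alt_path E C f ys" "hd ys = f c" "set ys \<inter> ?Z = {}" "y = last ys"
        by (auto simp: alt_reach_def)
      show "y \<in> ?N c"
        using augmenting_two_paths[OF w cC xs(1,2) fc(2) ys(1-3)] xs(3) ys(4)
        by (simp add: neighbours_def)
    qed
    then have "card (alt_reach E C f ?Z (f c)) \<le> card (?N c)" using finN card_mono by blast
    ultimately show ?thesis using Z small_def large by linarith
  qed
  have "card B \<le> card ?G + card {c \<in> C. f c \<in> ?Z \<union> ?D}"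
  proof -
    have "card B \<le> card (?G \<union> {c \<in> C. f c \<in> ?Z \<union> ?D})"
      by (rule card_mono) (use finB finC B in auto)
    then show ?thesis using card_Un_le order_trans by blast
  qed
  also have "card {c \<in> C. f c \<in> ?Z \<union> ?D} \<le> card (?Z \<union> ?D)"
    using finV by (intro card_preimage_le) auto
  also have "card (?Z \<union> ?D) \<le> card ?Z + card ?D" by (rule card_Un_le)
  \<comment> \<open>The path and the sources in \<open>?D\<close> exclude at most about
    \<open>n / 25\<close> elements, less than half of \<open>card B\<close>.\<close>
  finally have "card B \<le> 2 * card ?G" using Z D B(2) large by linarith
  then have "22 * ?n * card B \<le> 22 * ?n * (2 * card ?G)" by (intro mult_le_mono2)
  also have "\<dots> = 2 * (\<Sum>c\<in>?G. 22 * ?n)" by simp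
  also have "\<dots> \<le> 2 * (\<Sum>c\<in>?G. 50 * card (?N c))"
    using big by (intro mult_le_mono2 sum_mono) auto
  also have "\<dots> \<le> 2 * (\<Sum>c\<in>B. 50 * card (?N c))"
    using finB by (intro mult_le_mono2 sum_mono2) auto
  finally show ?thesis by (simp add: sum_distrib_left[symmetric])
qed

text \<open>Double counting over the exceptional \<open>c\<close> and the ball: on average, such a
  \<open>c\<close> would give \<open>0.22 n\<close> augmenting partners to each of almost
  \<open>n / 2\<close> vertices \<open>x\<close>, far more than the fewer than
  \<open>n^2 / 100\<close> pairs that it has.\<close>

lemma few_not_augmentable:
  assumes w: "w \<in> W" "v \<in> W" "v \<noteq> w" and large_w: "card V \<le> 50 * card (alt_reach E C f {} w)"
  shows "10 * card {c \<in> C. \<not> augmentable V (insert {v, c} E)} \<le> card V"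
proof (rule ccontr)
  let ?n = "card V" and ?B = "{c \<in> C. \<not> augmentable V (insert {v, c} E)}"
  let ?X = "alt_ball E C f ball_radius w" and ?A = "\<lambda>c. augmenting_pairs V (insert {v, c} E)"
  assume "\<not> 10 * card ?B \<le> ?n"
  then have B: "?n < 10 * card ?B" by simp
  have XV: "?X \<subseteq> V" using alt_ball_W[OF w(1)] by blast
  have "22 * ?n * card ?B * card ?X = (\<Sum>x\<in>?X. 22 * ?n * card ?B)" by simp
  also have "\<dots> \<le> (\<Sum>x\<in>?X. 100 * (\<Sum>c\<in>?B. card (neighbours (?A c) x)))"
    by (rule sum_mono) (rule neighbours_after_insert[OF w _ B], auto)
  also have "\<dots> = 100 * (\<Sum>c\<in>?B. \<Sum>x\<in>?X. card (neighbours (?A c) x))"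
    by (subst sum.swap) (simp add: sum_distrib_left)
  also have "\<dots> \<le> 100 * (\<Sum>c\<in>?B. 2 * card (?A c))"
  proof (intro mult_le_mono2 sum_mono)
    fix c
    have A: "?A c \<subseteq> nsets V 2" by (auto simp: augmenting_pairs_def)
    have "(\<Sum>x\<in>?X. card (neighbours (?A c) x)) = (\<Sum>e\<in>?A c. card (e \<inter> ?X))"
      using sum_card_inter_eq_sum_neighbours[OF finV A XV] by simp
    also have "\<dots> \<le> (\<Sum>e\<in>?A c. 2)"
    proof (rule sum_mono)
      fix e assume "e \<in> ?A c"
      then have "finite e" "card e = 2" using A by (auto simp: nsets_def)
      then show "card (e \<inter> ?X) \<le> 2" using card_mono[of e "e \<inter> ?X"] by auto
    qed
    finally show "(\<Sum>x\<in>?X. card (neighbours (?A c) x)) \<le> 2 * card (?A c)" by simp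
  qed
  also have "\<dots> = 2 * (\<Sum>c\<in>?B. 100 * card (?A c))" by (simp add: sum_distrib_left)
  also have "\<dots> \<le> 2 * (\<Sum>c\<in>?B. ?n^2)"
    by (intro mult_le_mono2 sum_mono) (auto simp: augmentable_def)
  finally have "22 * ?n * card ?B * card ?X \<le> 2 * card ?B * ?n * ?n"
    by (simp add: power2_eq_square mult_ac)
  then have "(card ?B * ?n) * (22 * card ?X) \<le> (card ?B * ?n) * (2 * ?n)"
    by (simp add: mult_ac)
  moreover have "card ?B * ?n > 0" using B large by simp
  ultimately have "22 * card ?X \<le> 2 * ?n" by simp
  then show False using ball_large[OF w(1) large_w] small_def large by linarith
qed

text \<open>The partners are the ball around \<open>w\<close> and those \<open>c\<close> for which
  \<open>{v, c}\<close> makes the graph augmentable, about \<open>0.48 n\<close> and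
  \<open>0.4 n\<close> of them. Partners in \<open>W\<close> are left out so that summing over
  \<open>v\<close> counts no pair twice.\<close>

lemma many_progress_pairs:
  assumes "card V \<le> 50 * card reached"
  obtains w where "w \<in> W"
    "\<forall>v\<in>W - {w}. 4 * card V \<le> 5 * card (neighbours (progress_pairs V E) v - W)"
proof -
  obtain w where w: "w \<in> W" "card V \<le> 50 * card (alt_reach E C f {} w)"
    using reached_large_source[OF assms] .
  have "4 * card V \<le> 5 * card (neighbours (progress_pairs V E) v - W)" if v: "v \<in> W - {w}" for v
  proof -
    let ?X = "alt_ball E C f ball_radius w"
    let ?B = "{c \<in> C. \<not> augmentable V (insert {v, c} E)}"
    let ?N = "neighbours (progress_pairs V E) v - W"
    have XR: "?X \<subseteq> alt_reach E C f {} w" by (rule alt_ball_subset_reach)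
    then have XV: "?X \<subseteq> V - C" using alt_reach_W[OF w(1)] by blast
    have X: "?X - W \<subseteq> ?N"
    proof
      fix x assume x: "x \<in> ?X - W"
      then have "{v, x} \<in> augmenting_pairs V E"
        using augmenting_from_reach[OF w(1)] v XR by blast
      then have "{v, x} \<in> progress_pairs V E"
        using konig_graph_insert_if_matching_number[OF finV EV konig]
        by (auto simp: augmenting_pairs_def progress_pairs_def)
      then show "x \<in> ?N" using x by (simp add: neighbours_def)
    qed
    have CB: "C - ?B \<subseteq> ?N"
    proof
      fix c assume c: "c \<in> C - ?B"
      have vc: "{v, c} \<in> nsets V 2" using v c CV by (auto simp: doubleton_in_nsets_2)
      have "konig_pair V (insert {v, c} E) C f" using c by (intro konig_pair_insert[OF pair]) auto
      then have "konig_graph V (insert {v, c} E)"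
        using konig_pairD(3)[OF finV _ ] EV vc by blast
      then show "c \<in> ?N" using c vc v by (auto simp: neighbours_def progress_pairs_def)
    qed
    have finN: "finite ?N"
      by (rule finite_subset[of _ V]) (auto simp: finV neighbours_def progress_pairs_def doubleton_in_nsets_2)
    have finX: "finite ?X" using XV finV finite_subset by blast
    have "card (?X - W) + card (C - ?B) = card ((?X - W) \<union> (C - ?B))"
      by (rule card_Un_disjoint[symmetric]) (use finX finC XV in auto)
    also have "\<dots> \<le> card ?N" by (rule card_mono[OF finN]) (use X CB in blast)
    finally have N: "card (?X - W) + card (C - ?B) \<le> card ?N" .
    have "card (?X - W) \<ge> card ?X - card W" using finV by (intro diff_card_le_card_Diff) auto
    moreover have "card (C - ?B) \<ge> card C - card ?B" using finC by (intro diff_card_le_card_Diff) auto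
    moreover have "10 * card ?B \<le> card V" using few_not_augmentable[OF w(1) _ _ w(2)] v by auto
    ultimately show ?thesis
      using N ball_large[OF w] card_W small_def large by linarith
  qed
  then show thesis by (intro that[OF w(1)]) blast
qed

end

section \<open>The early phase\<close>

lemma real_choose_two: "real (n choose 2) = real n * (real n - 1) / 2"
  by (induction n) (auto simp: numeral_2_eq_2 field_simps)

lemma sum_indicator_subset:
  fixes c d :: real
  assumes "finite S" "A \<subseteq> S"
  shows "(\<Sum>e\<in>S. c * (1 - d * indicator A e)) = c * (real (card S) - d * real (card A))"
proof -
  have "(\<Sum>e\<in>S. indicator A e) = real (card A)"
    using assms by (simp add: indicator_def of_bool_def sum.If_cases Int_absorb1)
  then have "(\<Sum>e\<in>S. 1 - d * indicator A e) = real (card S) - d * real (card A)"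
    by (simp add: sum_subtractf flip: sum_distrib_left)
  then show ?thesis by (simp flip: sum_distrib_left)
qed

lemma card_complete_graph: "finite V \<Longrightarrow> real (card (nsets V 2)) = real (card V) * (real (card V) - 1) / 2"
  by (simp add: card_nsets real_choose_two)

lemma konig_step_subset: "konig_step V e E \<subseteq> insert e E" "E \<subseteq> konig_step V e E"
  by (auto simp: konig_step_def)

lemma card_augmenting_pairs_ge:
  assumes V: "finite V" "E \<subseteq> nsets V 2" and pair: "konig_pair V E C f"
  shows "(card V - 2 * card C) choose 2 \<le> card (augmenting_pairs V E)"
proof -
  let ?W = "V - C - f ` C"
  have C: "C \<subseteq> V" "inj_on f C" "f ` C \<subseteq> V - C" using pair by (auto simp: konig_pair_def)
  have "card ?W = card V - card C - card (f ` C)"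
    using C V(1) by (simp add: card_Diff_subset finite_subset)
  then have W: "card ?W = card V - 2 * card C" using card_image[OF C(2)] by simp
  have "nsets ?W 2 \<subseteq> augmenting_pairs V E"
  proof
    fix e assume "e \<in> nsets ?W 2"
    then obtain u v where e: "e = {u, v}" "u \<noteq> v" "u \<in> ?W" "v \<in> ?W" by (rule nsets_2_obtain)
    then show "e \<in> augmenting_pairs V E"
      using matching_number_augment[OF V pair e(3,4,2)]
      by (simp add: augmenting_pairs_def doubleton_in_nsets_2)
  qed
  moreover have "finite (augmenting_pairs V E)"
    using V(1) by (simp add: augmenting_pairs_def finite_imp_finite_nsets)
  ultimately have "card (nsets ?W 2) \<le> card (augmenting_pairs V E)" by (rule card_mono[rotated])
  then show ?thesis using V(1) W by (simp add: card_nsets)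
qed

lemma augmenting_pairs_konig_step:
  assumes "finite V" "E \<subseteq> nsets V 2" "konig_graph V E" "e \<in> augmenting_pairs V E"
  shows "konig_step V e E = insert e E" "matching_number E < matching_number (konig_step V e E)"
  using konig_graph_insert_if_matching_number[OF assms(1-3)] assms(4)
  by (auto simp: augmenting_pairs_def konig_step_def)

text \<open>
  As long as \<open>B\<close> holds, each step increases \<open>\<nu>\<close> or destroys \<open>B\<close> with probability at least \<open>q\<close>, so
  \<open>2 ^ (- \<nu>) / (1 - q / 2) ^ t\<close> restricted to \<open>B\<close> is a supermartingale.
\<close>

lemma early_phase:
  fixes V :: "'a set" and q :: real and B :: "'a set set \<Rightarrow> bool"
  assumes V: "finite V" and t: "t \<le> card (nsets V 2)" and q: "0 \<le> q" "q \<le> 1"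
    and anti: "\<And>E e. finite E \<Longrightarrow> B (insert e E) \<Longrightarrow> B E"
    and prog: "\<And>P E. P \<subseteq> nsets V 2 \<Longrightarrow> card P < t \<Longrightarrow> E \<subseteq> nsets V 2 \<Longrightarrow> konig_graph V E \<Longrightarrow> B E \<Longrightarrow>
      q * real (card (nsets V 2)) \<le> real (card {e \<in> nsets V 2 - P.
        matching_number E < matching_number (konig_step V e E) \<or> \<not> B (konig_step V e E)})"
  shows "measure_pmf.prob (edge_ordering V) {es. B (process_graph V (take t es))}
    \<le> 2 ^ card V * (1 - q / 2) ^ t"
proof -
  let ?K = "nsets V 2" and ?G = "process_graph V"
  define r where "r = 1 - q / 2"
  have r: "0 < r" "r \<le> 1" using q by (auto simp: r_def)
  define \<Phi> where "\<Phi> p = (if B (?G p) then (1/2) ^ matching_number (?G p) / r ^ length p else 0)" for p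
  have finK: "finite ?K" using V by (simp add: finite_imp_finite_nsets)
  \<comment> \<open>A lower bound for \<open>\<Phi>\<close> at time \<open>t\<close> if
    \<open>B\<close> still holds, because the matching number is at most
    \<open>card V\<close>.\<close>
  define a where "a = (1/2) ^ card V / r ^ t"
  have a: "a > 0" using r by (simp add: a_def)
  have sub: "?G p \<subseteq> ?K" if "set p \<subseteq> ?K" for p using process_graph_subset that by blast
  have "measure_pmf.prob (pmf_of_set (permutations_of_set ?K))
      {es. a \<le> \<Phi> (take t es) \<and> (\<forall>s<t. True)} \<le> \<Phi> [] / a"
  proof (rule prob_permutations_le[OF finK t a])
    show "0 \<le> \<Phi> p" for p using r by (simp add: \<Phi>_def)
    fix p assume p: "distinct p" "set p \<subseteq> ?K" "length p < t"
    let ?S = "?K - set p" and ?E = "?G p"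
    have cS: "card ?S = card ?K - length p"
      using p finK by (simp add: card_Diff_subset distinct_card)
    show "(\<Sum>e\<in>?S. \<Phi> (p @ [e])) \<le> real (card ?K - length p) * \<Phi> p"
    proof (cases "B ?E")
      case False
      have "\<Phi> (p @ [e]) = 0" for e
        using False anti[of ?E e] finite_edges[OF V sub[OF p(2)]]
        by (auto simp: \<Phi>_def konig_step_def)
      then show ?thesis using False by (simp add: \<Phi>_def)
    next
      case True
      have finE: "finite ?E" by (rule finite_edges[OF V sub[OF p(2)]])
      define A where "A = {e \<in> ?K - set p. matching_number ?E < matching_number (konig_step V e ?E) \<or>
        \<not> B (konig_step V e ?E)}"
      have A: "q * real (card ?K) \<le> real (card A)"
        unfolding A_def using p
        by (intro prog sub process_graph_konig V True) (auto simp: distinct_card)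
      have AS: "A \<subseteq> ?S" by (auto simp: A_def)
      have bound: "\<Phi> (p @ [e]) \<le> \<Phi> p / r * (1 - 1/2 * indicator A e)" if "e \<in> ?S" for e
      proof (cases "B (konig_step V e ?E)")
        case False
        then show ?thesis using r by (auto simp: \<Phi>_def indicator_def)
      next
        case B: True
        have mono: "matching_number ?E \<le> matching_number (konig_step V e ?E)"
          using finE by (intro matching_number_mono) (auto simp: konig_step_def)
        have "(1/2) ^ matching_number (konig_step V e ?E) \<le>
            (1/2::real) ^ matching_number ?E * (1 - 1/2 * indicator A e)"
        proof (cases "e \<in> A")
          case True
          then have "Suc (matching_number ?E) \<le> matching_number (konig_step V e ?E)"
            using B by (auto simp: A_def)
          then have "(1/2) ^ matching_number (konig_step V e ?E) \<le> (1/2::real) ^ Suc (matching_number ?E)"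
            by (intro power_decreasing) auto
          then show ?thesis using True by simp
        next
          case False
          then show ?thesis using mono by (auto intro: power_decreasing)
        qed
        then show ?thesis using B True r by (simp add: \<Phi>_def field_simps)
      qed
      have "(\<Sum>e\<in>?S. \<Phi> (p @ [e])) \<le> (\<Sum>e\<in>?S. \<Phi> p / r * (1 - 1/2 * indicator A e))"
        by (rule sum_mono) (rule bound)
      also have "\<dots> = \<Phi> p / r * (real (card ?S) - real (card A) / 2)"
        using sum_indicator_subset[OF _ AS, of "\<Phi> p / r" "1/2"] finK by simp
      also have "\<dots> \<le> \<Phi> p / r * (real (card ?S) * r)"
      proof (rule mult_left_mono)
        have "q * real (card ?S) \<le> q * real (card ?K)"
          using q finK card_mono[OF finK Diff_subset, of "set p"]
          by (intro mult_left_mono) (simp_all only: of_nat_le_iff)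
        then show "real (card ?S) - real (card A) / 2 \<le> real (card ?S) * r"
          using A by (simp add: r_def algebra_simps)
        show "0 \<le> \<Phi> p / r" using r by (simp add: \<Phi>_def)
      qed
      also have "\<dots> = real (card ?K - length p) * \<Phi> p" using r cS by simp
      finally show ?thesis .
    qed
  qed
  moreover have "measure_pmf.prob (edge_ordering V) {es. B (?G (take t es))} \<le>
    measure_pmf.prob (edge_ordering V) {es. a \<le> \<Phi> (take t es) \<and> (\<forall>s<t. True)}"
  proof -
    have "{es. B (?G (take t es))} \<inter> set_pmf (edge_ordering V) \<subseteq>
        {es. a \<le> \<Phi> (take t es) \<and> (\<forall>s<t. True)}"
    proof
      fix es assume "es \<in> {es. B (?G (take t es))} \<inter> set_pmf (edge_ordering V)"
      then have es: "B (?G (take t es))" "es \<in> permutations_of_set ?K"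
        using finK by (auto simp: edge_ordering_def)
      then have "length (take t es) = t" "set (take t es) \<subseteq> ?K"
        using t by (auto simp: length_finite_permutations_of_set permutations_of_setD dest: in_set_takeD)
      moreover from this obtain C f where "konig_pair V (?G (take t es)) C f"
        using konig_graph_obtain_pair[OF V sub process_graph_konig[OF V]] by metis
      ultimately have "matching_number (?G (take t es)) \<le> card V"
        using konig_pairD(1)[OF V sub] konig_pair_card[OF V] by fastforce
      then have "(1/2::real) ^ card V \<le> (1/2) ^ matching_number (?G (take t es))"
        by (intro power_decreasing) auto
      then show "es \<in> {es. a \<le> \<Phi> (take t es) \<and> (\<forall>s<t. True)}"
        using es(1) \<open>length (take t es) = t\<close> r by (simp add: \<Phi>_def a_def divide_right_mono)
    qed
    then show ?thesis
      by (metis (no_types, lifting) measure_Int_set_pmf measure_pmf.finite_measure_mono sets_measure_pmf UNIV_I)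
  qed
  moreover have "\<Phi> [] / a \<le> 2 ^ card V * r ^ t"
  proof -
    have "\<Phi> [] \<le> 1" by (simp add: \<Phi>_def power_le_one)
    then have "\<Phi> [] / a \<le> 1 / a" using a by (simp add: divide_right_mono)
    then show ?thesis using r by (simp add: a_def power_divide)
  qed
  ultimately show ?thesis unfolding edge_ordering_def r_def by linarith
qed

section \<open>Matching number and expansion after linearly many steps\<close>

lemma card_Diff_ge_real:
  assumes "finite P" shows "real (card A) - real (card P) \<le> real (card (A - P))"
proof -
  have "card A - card P \<le> card (A - P)" using assms by (rule diff_card_le_card_Diff)
  then show ?thesis by linarith
qed

text \<open>A deficiency above \<open>n / 1000\<close> gives about \<open>n^2 / 2000000\<close>
  pairs of missed vertices, of which \<open>P\<close> removes at most
  \<open>n^2 / 100000000\<close>. The constant in the conclusion refers to all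
  \<open>n^2 / 2\<close> pairs and thus claims only half of that.\<close>

lemma many_augmenting_pairs:
  assumes V: "finite V" "E \<subseteq> nsets V 2" "konig_graph V E"
    and n: "1000000 \<le> card V" and d: "2000 * matching_number E < 999 * card V"
    and P: "P \<subseteq> nsets V 2" "100000000 * real (card P) \<le> real (card V) ^ 2"
  shows "1/2000000 * real (card (nsets V 2)) \<le> real (card (augmenting_pairs V E - P))"
proof -
  obtain C f where pair: "konig_pair V E C f" using konig_graph_obtain_pair V by metis
  define n where "n = real (card V)"
  have nu: "matching_number E = card C" using konig_pairD(1) V pair by metis
  let ?d = "card V - 2 * card C"
  have d': "n / 1000 \<le> real ?d" using d nu unfolding n_def by linarith
  have n6: "1000000 \<le> n" using n unfolding n_def by simp
  have finP: "finite P" using P(1) V(1) finite_edges by blast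
  have "(n / 1000) * (n / 1000 - 1) / 2 \<le> real ?d * (real ?d - 1) / 2"
    using d' n6 by (intro divide_right_mono mult_mono) auto
  also have "\<dots> = real (?d choose 2)" by (rule real_choose_two[symmetric])
  also have "\<dots> \<le> real (card (augmenting_pairs V E))"
    using card_augmenting_pairs_ge[OF V(1,2) pair] by simp
  finally have 1: "(n / 1000) * (n / 1000 - 1) / 2 \<le> real (card (augmenting_pairs V E))" .
  have "real (card (augmenting_pairs V E)) - real (card P) \<le> real (card (augmenting_pairs V E - P))"
    by (rule card_Diff_ge_real[OF finP])
  moreover have "100000000 * real (card P) \<le> n * n" using P(2) by (simp add: n_def power2_eq_square)
  moreover have "real (card (nsets V 2)) = n * (n - 1) / 2"
    using card_complete_graph[OF V(1)] by (simp add: n_def)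
  moreover have "1000000 * n \<le> n * n" using n6 by (intro mult_right_mono) auto
  ultimately show ?thesis using 1 by (simp add: algebra_simps)
qed

lemma prob_large_deficiency:
  assumes V: "finite V" and n: "1000000 \<le> card V"
    and t: "t \<le> card (nsets V 2)" "100000000 * real t \<le> real (card V) ^ 2"
  shows "measure_pmf.prob (edge_ordering V)
     {es. 2000 * matching_number (process_graph V (take t es)) < 999 * card V}
    \<le> 2 ^ card V * (1 - (1/2000000) / 2) ^ t"
proof (rule early_phase[OF V t(1)])
  fix E :: "'a set set" and e assume "finite E" "2000 * matching_number (insert e E) < 999 * card V"
  then show "2000 * matching_number E < 999 * card V"
    using matching_number_mono[of "insert e E" E] by fastforce
next
  fix P E assume P: "P \<subseteq> nsets V 2" "card P < t" and E: "E \<subseteq> nsets V 2" "konig_graph V E"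
    "2000 * matching_number E < 999 * card V"
  have "1/2000000 * real (card (nsets V 2)) \<le> real (card (augmenting_pairs V E - P))"
    by (rule many_augmenting_pairs[OF V E(1,2) n E(3) P(1)]) (use P t in auto)
  also have "\<dots> \<le> real (card {e \<in> nsets V 2 - P. matching_number E < matching_number (konig_step V e E) \<or>
      \<not> 2000 * matching_number (konig_step V e E) < 999 * card V})"
    using V augmenting_pairs_konig_step(2)[OF V E(1,2)]
    by (intro of_nat_mono card_mono) (auto simp: augmenting_pairs_def finite_imp_finite_nsets)
  finally show "1/2000000 * real (card (nsets V 2)) \<le> real (card {e \<in> nsets V 2 - P.
      matching_number E < matching_number (konig_step V e E) \<or>
      \<not> 2000 * matching_number (konig_step V e E) < 999 * card V})" .
qed auto

text \<open>
  All rejected pairs lie inside \<open>V - C\<close>, which spans about \<open>n^2 / 8\<close> pairs; hence a larger set of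
  pairs cannot be avoided for long.
\<close>

lemma prob_avoid_edges:
  assumes V: "finite V" and n: "1000000 \<le> card V"
    and t: "t \<le> card (nsets V 2)" "100000000 * real t \<le> real (card V) ^ 2"
    and F: "F \<subseteq> nsets V 2"
      "real (card V) ^ 2 / 8 - real (card V) / 4 + real (card V) ^ 2 / 2500 \<le> real (card F)"
  shows "measure_pmf.prob (edge_ordering V) {es. F \<inter> process_graph V (take t es) = {}}
    \<le> 2 ^ card V * (1 - (1/2000000) / 2) ^ t"
proof (rule early_phase[OF V t(1)])
  fix P E assume P: "P \<subseteq> nsets V 2" "card P < t" and E: "E \<subseteq> nsets V 2" "konig_graph V E"
    and FE: "F \<inter> E = {}"
  let ?T = "{e \<in> nsets V 2 - P. matching_number E < matching_number (konig_step V e E) \<or>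
      \<not> F \<inter> konig_step V e E = {}}"
  have finT: "finite ?T" using V by (simp add: finite_imp_finite_nsets)
  have cP: "100000000 * real (card P) \<le> real (card V) ^ 2" using P(2) t(2) by linarith
  show "1/2000000 * real (card (nsets V 2)) \<le> real (card ?T)"
  proof (cases "2000 * matching_number E < 999 * card V")
    case True
    have "1/2000000 * real (card (nsets V 2)) \<le> real (card (augmenting_pairs V E - P))"
      by (rule many_augmenting_pairs[OF V E n True P(1) cP])
    also have "\<dots> \<le> real (card ?T)"
      using finT augmenting_pairs_konig_step(2)[OF V E]
      by (intro of_nat_mono card_mono) (auto simp: augmenting_pairs_def)
    finally show ?thesis .
  next
    case False
    obtain C f where pair: "konig_pair V E C f" using konig_graph_obtain_pair[OF V E] by metis
    have C: "C \<subseteq> V" and nu: "matching_number E = card C"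
      using pair konig_pairD(1)[OF V E(1)] by (auto simp: konig_pair_def)
    define x where "x = real (card V)"
    have x6: "1000000 \<le> x" using n by (simp add: x_def)
    have finC: "finite C" and finP: "finite P" and finI: "finite (nsets (V - C) 2)"
      using C P(1) V finite_subset finite_edges by (auto simp: finite_imp_finite_nsets)
    have "card (V - C) = card V - card C" "card C \<le> card V"
      using C V finC by (auto simp: card_Diff_subset card_mono)
    \<comment> \<open>The pairs inside \<open>V - C\<close> number at most
      \<open>0.12526 n^2\<close>, against about \<open>0.1254 n^2\<close> in \<open>F\<close>; the
      deficiency bound \<open>n / 1000\<close> keeps this margin positive.\<close>
    then have VC: "real (card (V - C)) \<le> 1001 * x / 2000"
      using False nu unfolding x_def by linarith
    have "real (card (nsets (V - C) 2)) = real (card (V - C)) * (real (card (V - C)) - 1) / 2"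
      using V by (intro card_complete_graph) simp
    also have "\<dots> \<le> real (card (V - C)) * real (card (V - C)) / 2"
      by (intro divide_right_mono mult_left_mono) auto
    also have "\<dots> \<le> (1001 * x / 2000) * (1001 * x / 2000) / 2"
      using VC by (intro divide_right_mono mult_mono) auto
    finally have inner: "real (card (nsets (V - C) 2)) \<le> (1001 * x / 2000) * (1001 * x / 2000) / 2" .
    have sub: "F - P - nsets (V - C) 2 \<subseteq> ?T"
    proof
      fix e assume e: "e \<in> F - P - nsets (V - C) 2"
      then have eK: "e \<in> nsets V 2" using F(1) by blast
      have "e \<inter> C \<noteq> {}"
      proof
        assume "e \<inter> C = {}"
        then have "e \<in> nsets (V - C) 2" using eK by (auto simp: nsets_def)
        then show False using e by blast
      qed
      then have "konig_graph V (insert e E)"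
        using konig_pairD(3)[OF V _ konig_pair_insert[OF pair]] E(1) eK by blast
      then show "e \<in> ?T" using e eK by (auto simp: konig_step_def)
    qed
    have "real (card F) - real (card P) \<le> real (card (F - P))" by (rule card_Diff_ge_real[OF finP])
    moreover have "real (card (F - P)) - real (card (nsets (V - C) 2)) \<le>
        real (card (F - P - nsets (V - C) 2))" by (rule card_Diff_ge_real[OF finI])
    moreover have "real (card (F - P - nsets (V - C) 2)) \<le> real (card ?T)"
      using finT sub by (intro of_nat_mono card_mono)
    moreover have "1000000 * x \<le> x * x" using x6 by (intro mult_right_mono) auto
    moreover have "real (card (nsets V 2)) = x * (x - 1) / 2"
      using card_complete_graph[OF V] by (simp add: x_def)
    ultimately show ?thesis
      using F(2) cP inner by (simp add: x_def[symmetric] power2_eq_square algebra_simps)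
  qed
qed auto

definition edges_inside_or_between :: "'a set \<Rightarrow> 'a set \<Rightarrow> 'a set \<Rightarrow> 'a set set" where
  "edges_inside_or_between I S T = nsets I 2 \<union> (\<lambda>(s, t). {s, t}) ` (S \<times> T)"

text \<open>\<open>I\<close> alone spans about \<open>n^2 / 8\<close> pairs, as many as the
  complement of a minimum cover may, so all of them could be rejected. The \<open>(n / 50)^2\<close>
  pairs between \<open>S\<close> and \<open>T\<close> push the total above that, which is why
  \<open>expander\<close> treats \<open>I\<close> together with \<open>S\<close> and
  \<open>T\<close>.\<close>

lemma card_edges_inside_or_between:
  assumes V: "finite V" and sub: "I \<subseteq> V" "S \<subseteq> V" "T \<subseteq> V"
    and I: "card V \<le> 2 * card I" and dis: "T \<inter> I = {}" "S \<inter> T = {}"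
    and ST: "card V \<le> 50 * card S" "card V \<le> 50 * card T" and n: "2 \<le> card V"
  shows "edges_inside_or_between I S T \<subseteq> nsets V 2"
    "real (card V) ^ 2 / 8 - real (card V) / 4 + real (card V) ^ 2 / 2500
      \<le> real (card (edges_inside_or_between I S T))"
proof -
  let ?g = "\<lambda>(s, t). {s, t}"
  have fin: "finite I" "finite S" "finite T" using V sub by (auto intro: finite_subset[of _ V])
  show "edges_inside_or_between I S T \<subseteq> nsets V 2"
    using nsets_mono[OF sub(1)] sub dis
    by (auto simp: edges_inside_or_between_def doubleton_in_nsets_2)
  have "inj_on ?g (S \<times> T)"
    using dis(2) by (auto simp: inj_on_def doubleton_eq_iff)
  then have c: "card (?g ` (S \<times> T)) = card S * card T" by (simp add: card_image card_cartesian_product)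
  have "nsets I 2 \<inter> ?g ` (S \<times> T) = {}" using dis(1) by (auto simp: doubleton_in_nsets_2)
  then have "real (card (edges_inside_or_between I S T)) =
      real (card I) * (real (card I) - 1) / 2 + real (card S) * real (card T)"
    unfolding edges_inside_or_between_def using fin c card_complete_graph[OF fin(1)]
    by (subst card_Un_disjoint) (auto simp: finite_imp_finite_nsets)
  moreover have "(real (card V) / 2) * (real (card V) / 2 - 1) / 2 \<le>
      real (card I) * (real (card I) - 1) / 2"
    using I n by (intro divide_right_mono mult_mono) auto
  moreover have "(real (card V) / 50) * (real (card V) / 50) \<le> real (card S) * real (card T)"
    using ST by (intro mult_mono) auto
  ultimately show "real (card V) ^ 2 / 8 - real (card V) / 4 + real (card V) ^ 2 / 2500
      \<le> real (card (edges_inside_or_between I S T))"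
    by (simp add: power2_eq_square field_simps)
qed

lemma not_expander_obtain:
  assumes "\<not> expander V E"
  obtains I S T where "I \<subseteq> V \<and> S \<subseteq> V \<and> T \<subseteq> V \<and> card V \<le> 2 * card I \<and> T \<inter> I = {} \<and>
    S \<inter> T = {} \<and> card V \<le> 50 * card S \<and> card V \<le> 50 * card T"
    "edges_inside_or_between I S T \<inter> E = {}"
proof -
  obtain I S T where c: "I \<subseteq> V \<and> S \<subseteq> V \<and> T \<subseteq> V \<and> card V \<le> 2 * card I \<and> T \<inter> I = {} \<and>
      S \<inter> T = {} \<and> card V \<le> 50 * card S \<and> card V \<le> 50 * card T"
    and no: "\<not> (\<exists>e\<in>E. e \<subseteq> I \<or> (\<exists>s\<in>S. \<exists>t\<in>T. e = {s, t}))"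
    using assms unfolding expander_def not_all not_imp by (elim exE conjE) blast
  have "e \<notin> E" if "e \<in> edges_inside_or_between I S T" for e
  proof -
    have "e \<subseteq> I \<or> (\<exists>s\<in>S. \<exists>t\<in>T. e = {s, t})"
      using that by (auto simp: edges_inside_or_between_def nsets_def)
    then show ?thesis using no by blast
  qed
  then show thesis using that[OF c] by blast
qed

text \<open>A union bound over at most \<open>8^n\<close> triples turns the factor
  \<open>2^n\<close> into \<open>16^n\<close>.\<close>

lemma prob_not_expander:
  assumes V: "finite V" and n: "1000000 \<le> card V"
    and t: "t \<le> card (nsets V 2)" "100000000 * real t \<le> real (card V) ^ 2"
  shows "measure_pmf.prob (edge_ordering V) {es. \<not> expander V (process_graph V (take t es))}
    \<le> 16 ^ card V * (1 - (1/2000000) / 2) ^ t"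
proof -
  define \<F> where "\<F> = {(I, S, T). I \<subseteq> V \<and> S \<subseteq> V \<and> T \<subseteq> V \<and> card V \<le> 2 * card I \<and>
    T \<inter> I = {} \<and> S \<inter> T = {} \<and> card V \<le> 50 * card S \<and> card V \<le> 50 * card T}"
  define F where "F = (\<lambda>(I, S, T). edges_inside_or_between I S T :: 'a set set)"
  let ?A = "\<lambda>x. {es. F x \<inter> process_graph V (take t es) = {}}"
  let ?b = "2 ^ card V * (1 - (1/2000000) / 2) ^ t :: real"
  have sub: "\<F> \<subseteq> Pow V \<times> Pow V \<times> Pow V" by (auto simp: \<F>_def)
  have fin: "finite \<F>" by (rule finite_subset[OF sub]) (use V in auto)
  have "card \<F> \<le> card (Pow V \<times> Pow V \<times> Pow V)" by (rule card_mono[OF _ sub]) (use V in auto)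
  also have "\<dots> = 2 ^ card V * (2 ^ card V * 2 ^ card V)"
    using V by (simp add: card_cartesian_product card_Pow)
  also have "\<dots> = (2 * (2 * 2)) ^ card V" by (simp only: power_mult_distrib)
  also have "\<dots> = 8 ^ card V" by simp
  finally have cF: "card \<F> \<le> 8 ^ card V" .
  have "{es. \<not> expander V (process_graph V (take t es))} \<subseteq> (\<Union>x\<in>\<F>. ?A x)"
  proof
    fix es assume "es \<in> {es. \<not> expander V (process_graph V (take t es))}"
    then have "\<not> expander V (process_graph V (take t es))" by simp
    then obtain I S T where c: "I \<subseteq> V \<and> S \<subseteq> V \<and> T \<subseteq> V \<and> card V \<le> 2 * card I \<and> T \<inter> I = {} \<and>
        S \<inter> T = {} \<and> card V \<le> 50 * card S \<and> card V \<le> 50 * card T"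
      and "edges_inside_or_between I S T \<inter> process_graph V (take t es) = {}"
      by (rule not_expander_obtain)
    then have "es \<in> ?A (I, S, T)" by (simp add: F_def)
    moreover have x: "(I, S, T) \<in> \<F>" using c by (simp add: \<F>_def)
    ultimately show "es \<in> (\<Union>x\<in>\<F>. ?A x)" by (rule UN_I[rotated])
  qed
  then have "measure_pmf.prob (edge_ordering V) {es. \<not> expander V (process_graph V (take t es))} \<le>
      measure_pmf.prob (edge_ordering V) (\<Union>x\<in>\<F>. ?A x)"
    by (intro measure_pmf.finite_measure_mono) auto
  also have "\<dots> \<le> (\<Sum>x\<in>\<F>. measure_pmf.prob (edge_ordering V) (?A x))"
    by (rule measure_pmf.finite_measure_subadditive_finite[OF fin]) auto
  also have "\<dots> \<le> (\<Sum>x\<in>\<F>. ?b)"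
  proof (rule sum_mono)
    fix x assume "x \<in> \<F>"
    then obtain I S T where x: "x = (I, S, T)" "I \<subseteq> V" "S \<subseteq> V" "T \<subseteq> V" "card V \<le> 2 * card I"
      "T \<inter> I = {}" "S \<inter> T = {}" "card V \<le> 50 * card S" "card V \<le> 50 * card T"
      unfolding \<F>_def by blast
    have "F x \<subseteq> nsets V 2"
      "real (card V) ^ 2 / 8 - real (card V) / 4 + real (card V) ^ 2 / 2500 \<le> real (card (F x))"
      using card_edges_inside_or_between[OF V x(2-9)] n by (simp_all add: F_def x(1))
    then show "measure_pmf.prob (edge_ordering V) (?A x) \<le> ?b"
      by (rule prob_avoid_edges[OF V n t])
  qed
  also have "\<dots> = real (card \<F>) * ?b" by simp
  also have "\<dots> \<le> 8 ^ card V * ?b"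
    using cF by (intro mult_right_mono) (auto simp flip: of_nat_le_iff)
  also have "\<dots> = (8 * 2) ^ card V * (1 - (1/2000000) / 2) ^ t"
    by (simp only: power_mult_distrib mult.assoc)
  also have "\<dots> = 16 ^ card V * (1 - (1/2000000) / 2) ^ t" by simp
  finally show ?thesis .
qed

section \<open>Pairs already offered and their degrees\<close>

lemma remaining_pairs:
  assumes V: "finite V" and n: "1000000 \<le> card V"
    and P: "P \<subseteq> nsets V 2" "100000000 * real (card P) \<le> real (card V) ^ 2"
  shows "499 / 1000 * real (card V) ^ 2 \<le> real (card (nsets V 2 - P))"
proof -
  have finP: "finite P" using P(1) V finite_edges by blast
  have n6: "1000000 * real (card V) \<le> real (card V) * real (card V)"
    using n by (intro mult_right_mono) auto
  then show ?thesis
    using card_Diff_ge_real[OF finP, of "nsets V 2"] card_complete_graph[OF V] P(2)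
    by (simp add: power2_eq_square algebra_simps)
qed

text \<open>Mainly applied to the pairs offered so far, rejected ones included, so this is not the
  degree in the process graph.\<close>

definition incident :: "'a set set \<Rightarrow> 'a \<Rightarrow> 'a set set" where
  "incident P v = {e \<in> P. v \<in> e}"

lemma card_incident_le:
  assumes "finite V" shows "card (incident (nsets V 2) v) \<le> card V"
proof -
  have "incident (nsets V 2) v \<subseteq> (\<lambda>u. {v, u}) ` V"
  proof
    fix e assume e: "e \<in> incident (nsets V 2) v"
    then have "e \<in> nsets V 2" by (simp add: incident_def)
    then obtain a b where "e = {a, b}" "a \<in> V" "b \<in> V" by (rule nsets_2_obtain)
    then show "e \<in> (\<lambda>u. {v, u}) ` V" using e by (auto simp: incident_def insert_commute)
  qed
  then show ?thesis using assms by (meson card_image_le card_mono finite_imageI order_trans)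
qed

text \<open>A quantity that doubles with every offered pair at \<open>v\<close> grows on average by
  at most \<open>1 + 3 / n\<close> per step, since at most \<open>n\<close> of at least
  \<open>n^2 / 3\<close> remaining pairs contain \<open>v\<close>.\<close>

lemma prob_large_degree_vertex:
  assumes V: "finite V" and n: "1000000 \<le> card V"
    and t: "t \<le> card (nsets V 2)" "100000000 * real t \<le> real (card V) ^ 2"
  shows "measure_pmf.prob (edge_ordering V) {es. card V < 100 * card (incident (set (take t es)) v)}
     \<le> (1 + 3 / real (card V)) ^ t / 2 ^ (card V div 100)"
proof -
  let ?K = "nsets V 2" and ?n = "real (card V)"
  define r where "r = 1 + 3 / ?n"
  have n0: "?n > 0" using n by simp
  have r: "r > 0" using n0 unfolding r_def by (simp add: add_pos_nonneg)
  define \<Phi> where "\<Phi> p = 2 ^ card (incident (set p) v) / r ^ length p" for p :: "'a set list"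
  define a where "a = 2 ^ (card V div 100) / r ^ t"
  have a: "a > 0" using r by (simp add: a_def)
  have finK: "finite ?K" using V by (simp add: finite_imp_finite_nsets)
  have "measure_pmf.prob (pmf_of_set (permutations_of_set ?K))
      {es. a \<le> \<Phi> (take t es) \<and> (\<forall>s<t. True)} \<le> \<Phi> [] / a"
  proof (rule prob_permutations_le[OF finK t(1) a])
    show "0 \<le> \<Phi> p" for p using r by (simp add: \<Phi>_def)
    fix p assume p: "distinct p" "set p \<subseteq> ?K" "length p < t"
    let ?S = "?K - set p"
    define A where "A = {e \<in> ?S. v \<in> e}"
    have cS: "card ?S = card ?K - length p"
      using p finK by (simp add: card_Diff_subset distinct_card)
    have S: "499 / 1000 * ?n ^ 2 \<le> real (card ?S)"
      by (rule remaining_pairs[OF V n p(2)]) (use p t in \<open>auto simp: distinct_card\<close>)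
    have "A \<subseteq> incident ?K v" by (auto simp: A_def incident_def)
    moreover have "finite (incident ?K v)" using finK by (simp add: incident_def)
    ultimately have cA: "card A \<le> card V" using card_incident_le[OF V, of v] card_mono order_trans by metis
    have "\<Phi> (p @ [e]) = \<Phi> p / r * (1 - (-1) * indicator A e)" if e: "e \<in> ?S" for e
    proof -
      have "incident (set (p @ [e])) v = (if v \<in> e then insert e (incident (set p) v) else incident (set p) v)"
        by (auto simp: incident_def)
      moreover have "e \<notin> incident (set p) v" using e by (simp add: incident_def)
      moreover have "finite (incident (set p) v)" by (simp add: incident_def)
      ultimately show ?thesis using e by (simp add: \<Phi>_def A_def mult.commute)
    qed
    then have "(\<Sum>e\<in>?S. \<Phi> (p @ [e])) = (\<Sum>e\<in>?S. \<Phi> p / r * (1 - (-1) * indicator A e))"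
      by (rule sum.cong[OF refl])
    also have "\<dots> = \<Phi> p / r * (real (card ?S) - (-1) * real (card A))"
      by (rule sum_indicator_subset) (use finK in \<open>auto simp: A_def\<close>)
    also have "\<dots> \<le> \<Phi> p / r * (real (card ?S) * r)"
    proof (rule mult_left_mono)
      have "?n = (?n ^ 2 / 3) * (3 / ?n)" using n0 by (simp add: power2_eq_square)
      also have "\<dots> \<le> real (card ?S) * (3 / ?n)"
        using S n0 by (intro mult_right_mono) auto
      finally show "real (card ?S) - (-1) * real (card A) \<le> real (card ?S) * r"
        using cA unfolding r_def distrib_left by linarith
      show "0 \<le> \<Phi> p / r" using r by (simp add: \<Phi>_def)
    qed
    also have "\<dots> = real (card ?K - length p) * \<Phi> p" using r cS by simp
    finally show "(\<Sum>e\<in>?S. \<Phi> (p @ [e])) \<le> real (card ?K - length p) * \<Phi> p" .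
  qed
  moreover have "measure_pmf.prob (edge_ordering V) {es. card V < 100 * card (incident (set (take t es)) v)} \<le>
    measure_pmf.prob (edge_ordering V) {es. a \<le> \<Phi> (take t es) \<and> (\<forall>s<t. True)}"
  proof -
    have "{es. card V < 100 * card (incident (set (take t es)) v)} \<inter> set_pmf (edge_ordering V) \<subseteq>
        {es. a \<le> \<Phi> (take t es) \<and> (\<forall>s<t. True)}"
    proof
      fix es assume "es \<in> {es. card V < 100 * card (incident (set (take t es)) v)} \<inter> set_pmf (edge_ordering V)"
      then have es: "card V < 100 * card (incident (set (take t es)) v)" "es \<in> permutations_of_set ?K"
        using finK by (auto simp: edge_ordering_def)
      then have "length (take t es) = t"
        using t by (auto simp: length_finite_permutations_of_set)
      moreover have "card V div 100 \<le> card (incident (set (take t es)) v)" using es(1) by linarith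
      then have "(2::real) ^ (card V div 100) \<le> 2 ^ card (incident (set (take t es)) v)"
        by (intro power_increasing) auto
      ultimately show "es \<in> {es. a \<le> \<Phi> (take t es) \<and> (\<forall>s<t. True)}"
        using r by (simp add: \<Phi>_def a_def divide_right_mono)
    qed
    then show ?thesis
      by (metis (no_types, lifting) measure_Int_set_pmf measure_pmf.finite_measure_mono sets_measure_pmf UNIV_I)
  qed
  moreover have "\<Phi> [] / a = r ^ t / 2 ^ (card V div 100)"
    by (simp add: \<Phi>_def a_def incident_def)
  ultimately show ?thesis unfolding edge_ordering_def r_def by linarith
qed

lemma prob_large_degree:
  assumes V: "finite V" and n: "1000000 \<le> card V"
    and t: "t \<le> card (nsets V 2)" "100000000 * real t \<le> real (card V) ^ 2"
  shows "measure_pmf.prob (edge_ordering V)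
      {es. \<exists>v\<in>V. card V < 100 * card (incident (set (take t es)) v)}
     \<le> real (card V) * ((1 + 3 / real (card V)) ^ t / 2 ^ (card V div 100))"
proof -
  have "{es. \<exists>v\<in>V. card V < 100 * card (incident (set (take t es)) v)} =
      (\<Union>v\<in>V. {es. card V < 100 * card (incident (set (take t es)) v)})" by auto
  then have "measure_pmf.prob (edge_ordering V)
      {es. \<exists>v\<in>V. card V < 100 * card (incident (set (take t es)) v)} \<le>
      (\<Sum>v\<in>V. measure_pmf.prob (edge_ordering V) {es. card V < 100 * card (incident (set (take t es)) v)})"
    using measure_pmf.finite_measure_subadditive_finite[OF V] by auto
  also have "\<dots> \<le> (\<Sum>v\<in>V. (1 + 3 / real (card V)) ^ t / 2 ^ (card V div 100))"
    by (intro sum_mono prob_large_degree_vertex[OF V n t])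
  finally show ?thesis by simp
qed

section \<open>The potential\<close>

definition accepted_pairs :: "'a set \<Rightarrow> 'a set set \<Rightarrow> 'a set set" where
  "accepted_pairs V E = {e \<in> nsets V 2. konig_graph V (insert e E)}"

definition isolated :: "'a set \<Rightarrow> 'a set set \<Rightarrow> 'a set" where
  "isolated V E = {v. isolated_vertex V E v}"

definition deficiency :: "'a set \<Rightarrow> 'a set set \<Rightarrow> real" where
  "deficiency V E = real (card V) - 2 * real (matching_number E)"

text \<open>
  In an augmentable graph the next increase of \<open>\<nu>\<close> is imminent, and it is credited in advance. Since
  augmenting pairs persist until \<open>\<nu>\<close> increases, this quantity never increases. The shifts by 1000
  here and in the potential keep the relative changes small.
\<close>

definition shifted_deficiency :: "'a set \<Rightarrow> 'a set set \<Rightarrow> real" where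
  "shifted_deficiency V E = deficiency V E + 1000 - (if augmentable V E then 2 else 0)"

text \<open>
  The exponential factor pays for the augmentable states, in which \<open>\<nu>\<close> increases with constant
  probability per step; it is bounded because \<open>deficiency V E \<le> n\<close>.
\<close>

definition weight :: "'a set \<Rightarrow> 'a set set \<Rightarrow> real" where
  "weight V E = shifted_deficiency V E * exp (700 * deficiency V E / real (card V))"

definition potential :: "'a set \<Rightarrow> 'a set set \<Rightarrow> real" where
  "potential V E = weight V E / (real (card (isolated V E)) + 1000) ^ 3"

lemma isolated_subset: "isolated V E \<subseteq> V"
  by (auto simp: isolated_def isolated_vertex_def)

locale konig_state =
  fixes V :: "'a set" and E :: "'a set set"
  assumes finV: "finite V" and EV: "E \<subseteq> nsets V 2" and konig: "konig_graph V E"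
begin

lemma finE: "finite E" using finite_edges[OF finV EV] .

lemma deficiency_nonneg: "0 \<le> deficiency V E"
proof -
  obtain C f where pair: "konig_pair V E C f" using konig_graph_obtain_pair[OF finV EV konig] by metis
  show ?thesis
    using konig_pair_card[OF finV pair] konig_pairD(1)[OF finV EV pair] by (simp add: deficiency_def)
qed

lemma shifted_deficiency_ge: "998 \<le> shifted_deficiency V E"
  using deficiency_nonneg by (simp add: shifted_deficiency_def)

lemma weight_pos: "0 < weight V E"
  using shifted_deficiency_ge by (simp add: weight_def)

lemma potential_pos: "0 < potential V E"
  unfolding potential_def using weight_pos by (intro divide_pos_pos zero_less_power) (simp_all add: add_nonneg_pos)

lemma next_state: "e \<in> nsets V 2 \<Longrightarrow> konig_state V (konig_step V e E)"
  using finV EV konig_step_konig[OF konig] konig_step_subset(1)[of V e E]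
  by (auto simp: konig_state_def)

lemma augmentable_insert:
  assumes "matching_number (insert e E) = matching_number E" "augmentable V E"
  shows "augmentable V (insert e E)"
proof -
  have "augmenting_pairs V E \<subseteq> augmenting_pairs V (insert e E)"
  proof
    fix x assume x: "x \<in> augmenting_pairs V E"
    have "matching_number (insert x E) \<le> matching_number (insert x (insert e E))"
      using finE by (intro matching_number_mono) auto
    then show "x \<in> augmenting_pairs V (insert e E)"
      using x assms(1) by (simp add: augmenting_pairs_def)
  qed
  moreover have "finite (augmenting_pairs V (insert e E))"
    using finV by (simp add: augmenting_pairs_def finite_imp_finite_nsets)
  ultimately have "card (augmenting_pairs V E) \<le> card (augmenting_pairs V (insert e E))"
    by (rule card_mono[rotated])
  then show ?thesis using assms(2) by (simp add: augmentable_def)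
qed

lemma matching_number_insert_cases:
  "matching_number (insert e E) = matching_number E \<or>
   matching_number (insert e E) = Suc (matching_number E)"
  using matching_number_insert_le[OF finE, of e] matching_number_mono[of "insert e E" E] finE
  by fastforce

lemma deficiency_step_le: "deficiency V (konig_step V e E) \<le> deficiency V E"
  using matching_number_insert_cases[of e] by (auto simp: konig_step_def deficiency_def)

lemma shifted_deficiency_step:
  "shifted_deficiency V (konig_step V e E) \<le> shifted_deficiency V E"
  "e \<in> progress_pairs V E \<Longrightarrow> \<not> augmentable V E \<Longrightarrow>
    shifted_deficiency V (konig_step V e E) \<le> shifted_deficiency V E - 2"
  using matching_number_insert_cases[of e] augmentable_insert[of e]
  by (auto simp: konig_step_def shifted_deficiency_def deficiency_def progress_pairs_def)

lemma exp_deficiency_step: "exp (700 * deficiency V (konig_step V e E) / real (card V)) \<le>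
    exp (700 * deficiency V E / real (card V))"
  using deficiency_step_le[of e] by (simp add: divide_right_mono)

text \<open>An increase of the matching number lowers the deficiency by 2 and gains through the
  exponential factor; a progress pair gains through the first factor, even when the matching number
  does not change yet.\<close>

lemma weight_step:
  assumes e: "e \<in> nsets V 2"
  shows "weight V (konig_step V e E) \<le> weight V E"
    "e \<in> augmenting_pairs V E \<Longrightarrow>
      weight V (konig_step V e E) \<le> exp (- 1400 / real (card V)) * weight V E"
    "e \<in> progress_pairs V E \<Longrightarrow> \<not> augmentable V E \<Longrightarrow>
      weight V (konig_step V e E) \<le> (1 - 2 / shifted_deficiency V E) * weight V E"
proof -
  interpret nxt: konig_state V "konig_step V e E" by (rule next_state[OF e])
  let ?X = "shifted_deficiency V E" and ?X' = "shifted_deficiency V (konig_step V e E)"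
  have X: "0 \<le> ?X" "0 \<le> ?X'" using shifted_deficiency_ge nxt.shifted_deficiency_ge by auto
  show "weight V (konig_step V e E) \<le> weight V E"
    unfolding weight_def
    by (intro mult_mono shifted_deficiency_step(1) exp_deficiency_step) (use X in auto)
  show "weight V (konig_step V e E) \<le> exp (- 1400 / real (card V)) * weight V E"
    if "e \<in> augmenting_pairs V E"
  proof -
    have "Suc (matching_number E) \<le> matching_number (konig_step V e E)"
      using augmenting_pairs_konig_step(2)[OF finV EV konig that] by simp
    then have "deficiency V (konig_step V e E) \<le> deficiency V E - 2"
      by (simp add: deficiency_def)
    then have "700 * deficiency V (konig_step V e E) / real (card V) \<le> (- 1400 + 700 * deficiency V E) / real (card V)"
      by (intro divide_right_mono) auto
    then have "exp (700 * deficiency V (konig_step V e E) / real (card V)) \<le>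
        exp (- 1400 / real (card V)) * exp (700 * deficiency V E / real (card V))"
      by (simp add: exp_add[symmetric] add_divide_distrib diff_divide_distrib)
    then have "?X' * exp (700 * deficiency V (konig_step V e E) / real (card V)) \<le>
        ?X * (exp (- 1400 / real (card V)) * exp (700 * deficiency V E / real (card V)))"
      by (intro mult_mono shifted_deficiency_step(1)) (use X in auto)
    then show ?thesis by (simp add: weight_def mult_ac)
  qed
  show "weight V (konig_step V e E) \<le> (1 - 2 / ?X) * weight V E"
    if "e \<in> progress_pairs V E" "\<not> augmentable V E"
  proof -
    have "?X' * exp (700 * deficiency V (konig_step V e E) / real (card V)) \<le>
        (?X - 2) * exp (700 * deficiency V E / real (card V))"
      by (intro mult_mono shifted_deficiency_step(2)[OF that] exp_deficiency_step)
        (use X shifted_deficiency_ge in auto)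
    moreover have "?X - 2 = (1 - 2 / ?X) * ?X"
      using shifted_deficiency_ge by (simp add: field_simps)
    ultimately show ?thesis by (simp add: weight_def mult.assoc)
  qed
qed

section \<open>Lost isolated vertices and the drift of the potential\<close>

definition killed :: "'a set \<Rightarrow> nat" where
  "killed e = (if konig_graph V (insert e E) then card (e \<inter> isolated V E) else 0)"

lemma isolated_step:
  assumes e: "e \<in> nsets V 2"
  shows "card (isolated V E) \<le> card (isolated V (konig_step V e E)) + killed e" "killed e \<le> 2"
proof -
  have fin: "finite e" and ce: "card e = 2" using e by (auto simp: nsets_def)
  have finI: "finite (isolated V E')" for E' using isolated_subset finV finite_subset by metis
  show "card (isolated V E) \<le> card (isolated V (konig_step V e E)) + killed e"
  proof (cases "konig_graph V (insert e E)")
    case True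
    have "isolated V E \<subseteq> isolated V (konig_step V e E) \<union> (e \<inter> isolated V E)"
      using True by (auto simp: isolated_def isolated_vertex_def konig_step_def)
    then have "card (isolated V E) \<le> card (isolated V (konig_step V e E) \<union> (e \<inter> isolated V E))"
      using finI fin by (intro card_mono) auto
    also have "\<dots> \<le> card (isolated V (konig_step V e E)) + card (e \<inter> isolated V E)"
      by (rule card_Un_le)
    finally show ?thesis using True by (simp add: killed_def)
  qed (simp add: konig_step_def)
  show "killed e \<le> 2"
    using card_mono[OF fin, of "e \<inter> isolated V E"] ce by (auto simp: killed_def)
qed

text \<open>The factor \<open>61 / 20\<close> replaces the 3 that comes from the cube: thanks to the
  shift by 1000 the relative change \<open>z\<close> is at most \<open>1 / 500\<close>, and the
  excess \<open>1 / 20\<close> absorbs the higher terms of \<open>(1 - z)^(-3)\<close>.\<close>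

lemma potential_step:
  assumes e: "e \<in> nsets V 2" and D: "0 \<le> D" "D \<le> 1"
    and w: "weight V (konig_step V e E) \<le> (1 - D) * weight V E"
  shows "potential V (konig_step V e E) \<le>
    potential V E * (1 + 61 / 20 * real (killed e) / (real (card (isolated V E)) + 1000) - D)"
proof -
  define Y where "Y = real (card (isolated V E)) + 1000"
  define Y' where "Y' = real (card (isolated V (konig_step V e E))) + 1000"
  define k where "k = real (killed e)"
  define z where "z = k / Y"
  have k: "0 \<le> k" "k \<le> 2" "Y - k \<le> Y'" and Y: "1000 \<le> Y" "0 < Y'"
    using isolated_step[OF e] by (auto simp: Y_def Y'_def k_def add_nonneg_pos)
  have z: "0 \<le> z" "z \<le> 1 / 500"
    using k Y by (auto simp: z_def field_simps)
  have Yz: "Y * (1 - z) = Y - k" using Y by (simp add: z_def field_simps)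
  have "1 \<le> (1 - 3 * z) * (1 + 61 / 20 * z)"
    using mult_mono[of z "1 / 500" z z] z by (simp add: algebra_simps)
  also have "\<dots> \<le> (1 - z) ^ 3 * (1 + 61 / 20 * z)"
  proof (rule mult_right_mono)
    have "(1 - z) ^ 3 - (1 - 3 * z) = z * z * (3 - z)" by (simp add: power3_eq_cube algebra_simps)
    moreover have "0 \<le> z * z * (3 - z)" using z by simp
    ultimately show "1 - 3 * z \<le> (1 - z) ^ 3" by linarith
  qed (use z in simp)
  finally have "Y ^ 3 * 1 \<le> Y ^ 3 * ((1 - z) ^ 3 * (1 + 61 / 20 * z))"
    using Y by (intro mult_left_mono) auto
  also have "\<dots> = (Y - k) ^ 3 * (1 + 61 / 20 * z)"
    by (simp flip: Yz add: power_mult_distrib)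
  also have "\<dots> \<le> Y' ^ 3 * (1 + 61 / 20 * z)"
    using k Y z by (intro mult_right_mono power_mono) auto
  finally have "1 / Y' ^ 3 \<le> (1 + 61 / 20 * z) / Y ^ 3"
    using Y by (simp add: field_simps)
  then have "weight V (konig_step V e E) * (1 / Y' ^ 3) \<le>
      ((1 - D) * weight V E) * ((1 + 61 / 20 * z) / Y ^ 3)"
    using w weight_pos D Y by (intro mult_mono) auto
  also have "\<dots> = weight V E / Y ^ 3 * ((1 - D) * (1 + 61 / 20 * z))" by simp
  also have "\<dots> \<le> weight V E / Y ^ 3 * (1 + 61 / 20 * z - D)"
    using weight_pos Y D z by (intro mult_left_mono) (auto simp: algebra_simps)
  finally show ?thesis by (simp add: potential_def Y_def Y'_def z_def k_def)
qed

lemma sum_killed: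
  assumes "S \<subseteq> nsets V 2"
    and \<kappa>: "\<And>v. isolated_vertex V E v \<Longrightarrow> real (card (neighbours (accepted_pairs V E) v)) \<le> \<kappa>"
  shows "(\<Sum>e\<in>S. real (killed e)) \<le> real (card (isolated V E)) * \<kappa>"
proof -
  let ?A = "accepted_pairs V E" and ?I = "isolated V E"
  have A: "?A \<subseteq> nsets V 2" by (auto simp: accepted_pairs_def)
  have fin: "finite ?A" "finite S"
    using finV assms(1) finite_edges A by blast+
  have "(\<Sum>e\<in>S. killed e) = (\<Sum>e\<in>S \<inter> ?A. card (e \<inter> ?I))"
    using assms(1) fin by (simp add: sum.inter_restrict killed_def accepted_pairs_def)
      (auto intro!: sum.cong)
  also have "\<dots> \<le> (\<Sum>e\<in>?A. card (e \<inter> ?I))" using fin by (intro sum_mono2) auto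
  also have "\<dots> = (\<Sum>v\<in>?I. card (neighbours ?A v))"
    by (rule sum_card_inter_eq_sum_neighbours[OF finV A isolated_subset])
  finally have "real (\<Sum>e\<in>S. killed e) \<le> real (\<Sum>v\<in>?I. card (neighbours ?A v))" by (rule of_nat_mono)
  also have "\<dots> = (\<Sum>v\<in>?I. real (card (neighbours ?A v)))" by simp
  also have "\<dots> \<le> (\<Sum>v\<in>?I. \<kappa>)" by (rule sum_mono) (use \<kappa> in \<open>auto simp: isolated_def\<close>)
  finally show ?thesis by simp
qed

text \<open>The common form of all drift estimates: \<open>\<kappa> n\<close> bounds the accepted
  partners of an isolated vertex, \<open>d\<close> is the relative loss of weight on the pairs in
  \<open>A\<close>, and \<open>\<mu> / n\<close> is the resulting growth rate. The factor
  \<open>499 / 1000\<close> stands for the almost \<open>n^2 / 2\<close> pairs still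
  available.\<close>

lemma potential_drift:
  assumes S: "S \<subseteq> nsets V 2" "499 / 1000 * real (card V) ^ 2 \<le> real (card S)" and V0: "0 < card V"
    and \<kappa>: "\<And>v. isolated_vertex V E v \<Longrightarrow>
      real (card (neighbours (accepted_pairs V E) v)) \<le> \<kappa> * real (card V)"
    and A: "A \<subseteq> S" "0 \<le> d" "d \<le> 1"
      "\<And>e. e \<in> A \<Longrightarrow> weight V (konig_step V e E) \<le> (1 - d) * weight V E"
    and bal: "61 / 20 * \<kappa> * real (card V) *
        (real (card (isolated V E)) / (real (card (isolated V E)) + 1000)) - d * real (card A)
      \<le> 499 / 1000 * \<mu> * real (card V)" "0 \<le> \<mu>"
  shows "(\<Sum>e\<in>S. potential V (konig_step V e E)) \<le>
    real (card S) * ((1 + \<mu> / real (card V)) * potential V E)"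
proof -
  let ?I = "real (card (isolated V E))" and ?n = "real (card V)"
  have finS: "finite S" using S(1) finV finite_edges by blast
  have "(\<Sum>e\<in>S. potential V (konig_step V e E)) \<le>
      (\<Sum>e\<in>S. potential V E * (1 + 61 / 20 * real (killed e) / (?I + 1000) - d * indicator A e))"
  proof (rule sum_mono)
    fix e assume e: "e \<in> S"
    have "potential V (konig_step V e E) \<le>
        potential V E * (1 + 61 / 20 * real (killed e) / (?I + 1000) - (if e \<in> A then d else 0))"
      using e S(1) A weight_step(1)[of e] by (intro potential_step) auto
    then show "potential V (konig_step V e E) \<le>
        potential V E * (1 + 61 / 20 * real (killed e) / (?I + 1000) - d * indicator A e)"
      by (simp add: indicator_def of_bool_def split: if_splits)
  qed
  also have "\<dots> = (\<Sum>e\<in>S. potential V E *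
      (1 * (1 - d * indicator A e) + 61 / 20 / (?I + 1000) * real (killed e)))"
    by (rule sum.cong) (simp_all add: algebra_simps)
  also have "\<dots> = potential V E *
      (\<Sum>e\<in>S. 1 * (1 - d * indicator A e) + 61 / 20 / (?I + 1000) * real (killed e))"
    by (simp only: sum_distrib_left)
  also have "(\<Sum>e\<in>S. 1 * (1 - d * indicator A e) + 61 / 20 / (?I + 1000) * real (killed e)) =
      (\<Sum>e\<in>S. 1 * (1 - d * indicator A e)) + 61 / 20 / (?I + 1000) * (\<Sum>e\<in>S. real (killed e))"
    by (simp only: sum_distrib_left sum.distrib)
  also have "(\<Sum>e\<in>S. 1 * (1 - d * indicator A e)) = real (card S) - d * real (card A)"
    using sum_indicator_subset[OF finS A(1), of 1 d] by simp
  also have "potential V E * (real (card S) - d * real (card A)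
      + 61 / 20 / (?I + 1000) * (\<Sum>e\<in>S. real (killed e))) \<le>
    potential V E * (real (card S) * (1 + \<mu> / ?n))"
  proof (rule mult_left_mono)
    have "61 / 20 / (?I + 1000) * (\<Sum>e\<in>S. real (killed e)) \<le> 61 / 20 / (?I + 1000) * (?I * (\<kappa> * ?n))"
      by (intro mult_left_mono sum_killed S(1) \<kappa>) auto
    also have "\<dots> = 61 / 20 * \<kappa> * ?n * (?I / (?I + 1000))" by simp
    finally have 1: "61 / 20 / (?I + 1000) * (\<Sum>e\<in>S. real (killed e)) - d * real (card A) \<le>
        499 / 1000 * \<mu> * ?n" using bal(1) by linarith
    have "499 / 1000 * \<mu> * ?n = 499 / 1000 * ?n ^ 2 * (\<mu> / ?n)" using V0 by (simp add: power2_eq_square)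
    also have "\<dots> \<le> real (card S) * (\<mu> / ?n)" using S(2) bal(2) by (intro mult_right_mono) auto
    finally show "real (card S) - d * real (card A)
        + 61 / 20 / (?I + 1000) * (\<Sum>e\<in>S. real (killed e)) \<le> real (card S) * (1 + \<mu> / ?n)"
      using 1 unfolding distrib_left by linarith
  qed (use potential_pos in simp)
  finally show ?thesis by (simp add: mult_ac)
qed

lemma card_neighbours_le: "A \<subseteq> nsets V 2 \<Longrightarrow> card (neighbours A v) \<le> card V"
  by (rule card_mono[OF finV neighbours_subset])

lemma isolated_fraction_le_1: "real (card (isolated V E)) / (real (card (isolated V E)) + 1000) \<le> 1"
  by (simp add: divide_le_eq add_nonneg_pos)

text \<open>Even if every pair is accepted, the rate is \<open>3.05 / 0.499 < 8\<close>. Over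
  \<open>O(n)\<close> steps this costs only a constant factor.\<close>

lemma potential_drift_trivial:
  assumes S: "S \<subseteq> nsets V 2" "499 / 1000 * real (card V) ^ 2 \<le> real (card S)" and V0: "0 < card V"
  shows "(\<Sum>e\<in>S. potential V (konig_step V e E)) \<le>
    real (card S) * ((1 + 8 / real (card V)) * potential V E)"
proof (rule potential_drift[OF S V0, where \<kappa> = 1 and A = "{}" and d = 0])
  show "real (card (neighbours (accepted_pairs V E) v)) \<le> 1 * real (card V)" for v
    using card_neighbours_le[of "accepted_pairs V E" v] by (auto simp: accepted_pairs_def)
  have "61 / 20 * 1 * real (card V) * (real (card (isolated V E)) / (real (card (isolated V E)) + 1000))
      \<le> 61 / 20 * 1 * real (card V) * 1"
    by (intro mult_left_mono isolated_fraction_le_1) auto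
  then show "61 / 20 * 1 * real (card V) * (real (card (isolated V E)) / (real (card (isolated V E)) + 1000))
      - 0 * real (card {}) \<le> 499 / 1000 * 8 * real (card V)" by simp
qed auto

text \<open>The rate \<open>19 / 5\<close> is dictated by the case of few reached vertices, where
  3.05 times 0.57, that is 1.7385, has to stay below 0.499 times 3.8, that is 1.8962.\<close>

lemma potential_drift_expander:
  assumes n: "1000000 \<le> card V" and exp: "expander V E"
    and d: "999 * card V \<le> 2000 * matching_number E"
    and P: "P \<subseteq> nsets V 2" "100000000 * real (card P) \<le> real (card V) ^ 2"
    and deg: "\<And>v. v \<in> V \<Longrightarrow> 100 * card (incident P v) \<le> card V"
  shows "(\<Sum>e\<in>nsets V 2 - P. potential V (konig_step V e E)) \<le>
    real (card (nsets V 2 - P)) * ((1 + 19 / 5 / real (card V)) * potential V E)"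
proof -
  obtain C f where pair: "konig_pair V E C f" using konig_graph_obtain_pair[OF finV EV konig] by metis
  have nu: "matching_number E = card C" by (rule konig_pairD(1)[OF finV EV pair])
  interpret konig_expander V E C f
    by unfold_locales (use finV EV pair exp d nu n in auto)
  let ?n = "real (card V)" and ?S = "nsets V 2 - P" and ?I = "real (card (isolated V E))"
  have n6: "1000000 \<le> ?n" using n by simp
  have finP: "finite P" using P(1) finV finite_edges by blast
  have S: "?S \<subseteq> nsets V 2" "499 / 1000 * ?n ^ 2 \<le> real (card ?S)" "0 < card V"
    using remaining_pairs[OF finV n P] n by auto
  have acc: "real (card (neighbours (accepted_pairs V E) v)) \<le> 1 * ?n" for v
    using card_neighbours_le[of "accepted_pairs V E" v] by (auto simp: accepted_pairs_def)
  have frac: "61 / 20 * 1 * ?n * (?I / (?I + 1000)) \<le> 61 / 20 * ?n"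
    using mult_left_mono[OF isolated_fraction_le_1, of "61 / 20 * ?n"] by simp
  consider (aug) "augmentable V E" | (few) "\<not> augmentable V E" "50 * card reached < card V"
    | (many) "\<not> augmentable V E" "card V \<le> 50 * card reached" by linarith
  then show ?thesis
  proof cases
    case aug
    \<comment> \<open>Here the 700 in \<open>weight\<close> pays: a relative loss of
      \<open>700 / n\<close> on at least \<open>0.009 n^2\<close> pairs outweighs
      \<open>3.05 n\<close>, the most that lost isolated vertices can contribute.\<close>
    let ?A = "augmenting_pairs V E - P" and ?d = "1 - exp (- 1400 / ?n)"
    have "exp (- 1400 / ?n) \<le> 1 - 700 / ?n"
    proof -
      define x where "x = 1400 / ?n"
      have x: "0 \<le> x" "x \<le> 1" using n6 by (auto simp: x_def field_simps)
      have "1 \<le> (1 - x / 2) * (1 + x)" using mult_mono[of x 1 x x] x by (simp add: algebra_simps)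
      also have "\<dots> \<le> (1 - x / 2) * exp x" using x exp_ge_add_one_self[of x] by (intro mult_left_mono) auto
      finally have "exp (- x) \<le> 1 - x / 2" by (simp add: exp_minus field_simps)
      then show ?thesis by (simp add: x_def)
    qed
    then have d: "700 / ?n \<le> ?d" by simp
    have "real (card (augmenting_pairs V E)) - real (card P) \<le> real (card ?A)"
      by (rule card_Diff_ge_real[OF finP])
    moreover have "?n ^ 2 \<le> 100 * real (card (augmenting_pairs V E))"
      using aug unfolding augmentable_def by (metis of_nat_le_iff of_nat_mult of_nat_numeral of_nat_power)
    ultimately have cA: "9 / 1000 * ?n ^ 2 \<le> real (card ?A)" using P(2) zero_le_power2[of ?n] by linarith
    have "63 / 10 * ?n = 700 / ?n * (9 / 1000 * ?n ^ 2)" using n6 by (simp add: power2_eq_square)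
    also have "\<dots> \<le> ?d * real (card ?A)" using d cA by (intro mult_mono) auto
    finally have bal: "63 / 10 * ?n \<le> ?d * real (card ?A)" .
    show ?thesis
    proof (rule potential_drift[OF S acc, where A = ?A and d = ?d])
      show "weight V (konig_step V e E) \<le> (1 - ?d) * weight V E" if "e \<in> ?A" for e
        using weight_step(2)[of e] that by (auto simp: augmenting_pairs_def)
      show "61 / 20 * 1 * ?n * (?I / (?I + 1000)) - ?d * real (card ?A) \<le> 499 / 1000 * (19 / 5) * ?n"
        using frac bal n6 by linarith
    qed (auto simp: augmenting_pairs_def)
  next
    case few
    show ?thesis
    proof (rule potential_drift[OF S, where A = "{}" and d = 0 and \<kappa> = "57 / 100"])
      fix v assume "isolated_vertex V E v"
      then have "100 * card {u. {v, u} \<in> nsets V 2 \<and> konig_graph V (insert {v, u} E)} \<le> 57 * card V"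
        by (rule isolated_accepted_few[OF _ few(2)])
      moreover have "{u. {v, u} \<in> nsets V 2 \<and> konig_graph V (insert {v, u} E)} =
          neighbours (accepted_pairs V E) v" by (simp add: neighbours_def accepted_pairs_def)
      ultimately have "100 * card (neighbours (accepted_pairs V E) v) \<le> 57 * card V" by simp
      then show "real (card (neighbours (accepted_pairs V E) v)) \<le> 57 / 100 * ?n" by linarith
    next
      have "61 / 20 * (57 / 100) * ?n * (?I / (?I + 1000)) \<le> 61 / 20 * (57 / 100) * ?n"
        using mult_left_mono[OF isolated_fraction_le_1, of "61 / 20 * (57 / 100) * ?n"] by simp
      then show "61 / 20 * (57 / 100) * ?n * (?I / (?I + 1000)) - 0 * real (card {}) \<le> 499 / 1000 * (19 / 5) * ?n"
        using n6 by linarith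
    qed auto
  next
    case many
    let ?A = "progress_pairs V E - P" and ?X = "shifted_deficiency V E"
    have AV: "?A \<subseteq> nsets V 2" by (auto simp: progress_pairs_def)
    then have finA: "finite ?A" using finV finite_edges by blast
    obtain w where w: "w \<in> W"
      "\<forall>v\<in>W - {w}. 4 * card V \<le> 5 * card (neighbours (progress_pairs V E) v - W)"
      by (rule many_progress_pairs[OF many(2)])
    let ?J = "W - {w}"
    \<comment> \<open>With at most one end of each pair in \<open>?J\<close>, the sum of degrees
      over \<open>?J\<close> is a lower bound for the number of pairs.\<close>
    define B where "B = {e \<in> ?A. card (e \<inter> ?J) \<le> 1}"
    have BV: "B \<subseteq> nsets V 2" using AV by (auto simp: B_def)
    \<comment> \<open>\<open>79 / 100\<close> is \<open>4 / 5\<close> less the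
      \<open>1 / 100\<close> of partners that may already have been offered to
      \<open>v\<close>.\<close>
    have nb: "79 / 100 * ?n \<le> real (card (neighbours B v))" if v: "v \<in> ?J" for v
    proof -
      let ?N = "neighbours (progress_pairs V E) v - W"
      have finN: "finite (neighbours B v)" using neighbours_subset[OF BV] finV finite_subset by blast
      have finPn: "finite {u. {v, u} \<in> P}"
        by (rule finite_subset[of _ V]) (use P(1) finV in \<open>auto simp: doubleton_in_nsets_2 dest!: subsetD\<close>)
      have "card {u. {v, u} \<in> P} \<le> card (incident P v)"
        by (rule card_inj_on_le[of "\<lambda>u. {v, u}"])
          (use finP in \<open>auto simp: inj_on_def doubleton_eq_iff incident_def\<close>)
      then have cP: "100 * card {u. {v, u} \<in> P} \<le> card V" using deg[of v] v by auto
      have "?N - {u. {v, u} \<in> P} \<subseteq> neighbours B v"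
      proof
        fix u assume u: "u \<in> ?N - {u. {v, u} \<in> P}"
        then have "{v, u} \<in> ?A" by (simp add: neighbours_def)
        moreover have "{v, u} \<inter> ?J \<subseteq> {v}" using u by auto
        then have "card ({v, u} \<inter> ?J) \<le> 1" using card_mono[of "{v}"] by auto
        ultimately show "u \<in> neighbours B v" by (simp add: neighbours_def B_def)
      qed
      then have "card (?N - {u. {v, u} \<in> P}) \<le> card (neighbours B v)" by (rule card_mono[OF finN])
      moreover have "card ?N - card {u. {v, u} \<in> P} \<le> card (?N - {u. {v, u} \<in> P})"
        by (rule diff_card_le_card_Diff[OF finPn])
      ultimately show ?thesis using bspec[OF w(2) v] cP by linarith
    qed
    have "real (card ?J) * (79 / 100 * ?n) = (\<Sum>v\<in>?J. 79 / 100 * ?n)" by simp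
    also have "\<dots> \<le> (\<Sum>v\<in>?J. real (card (neighbours B v)))" by (rule sum_mono) (rule nb)
    also have "\<dots> = real (\<Sum>e\<in>B. card (e \<inter> ?J))"
      by (subst sum_card_inter_eq_sum_neighbours[OF finV BV]) auto
    also have "\<dots> \<le> real (\<Sum>e\<in>B. 1)" by (intro of_nat_mono sum_mono) (simp add: B_def)
    also have "\<dots> \<le> real (card ?A)" using finA by (auto simp: B_def intro!: card_mono)
    finally have cA: "real (card ?J) * (79 / 100 * ?n) \<le> real (card ?A)" .
    have "card ?J = card W - 1" using w(1) finV by simp
    moreover have "deficiency V E = real (card W)"
      using card_W nu unfolding deficiency_def by linarith
    moreover have "card W > 0" using w(1) finV card_gt_0_iff by blast
    ultimately have cJ: "real (card ?J) = deficiency V E - 1" and D1: "1 \<le> deficiency V E" by linarith+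
    have X: "?X = deficiency V E + 1000" using many(1) by (simp add: shifted_deficiency_def)
    \<comment> \<open>An isolated vertex is an end of no matching edge. This gives
      \<open>i \<le> d\<close>, which ties the loss of isolated vertices to the decay of the
      deficiency.\<close>
    have "isolated V E \<subseteq> W"
    proof
      fix v assume "v \<in> isolated V E"
      then have v: "v \<in> V" "\<And>e. e \<in> E \<Longrightarrow> v \<notin> e" by (auto simp: isolated_def isolated_vertex_def)
      have "c \<noteq> v \<and> f c \<noteq> v" if "c \<in> C" for c using v(2)[OF edge[OF that]] by auto
      then show "v \<in> W" using v(1) by auto
    qed
    then have "card (isolated V E) \<le> card W" using finV by (intro card_mono) auto
    then have "?I \<le> deficiency V E" using cJ \<open>card ?J = card W - 1\<close> \<open>card W > 0\<close> by linarith
    then have I: "?I / (?I + 1000) \<le> deficiency V E / ?X"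
      unfolding X by (simp add: field_simps)
    show ?thesis
    proof (rule potential_drift[OF S acc, where A = ?A and d = "2 / ?X"])
      show "weight V (konig_step V e E) \<le> (1 - 2 / ?X) * weight V E" if "e \<in> ?A" for e
        using weight_step(3)[of e] that many(1) by (auto simp: progress_pairs_def)
      have "61 / 20 * 1 * ?n * (?I / (?I + 1000)) \<le> 61 / 20 * ?n * (deficiency V E / ?X)"
        using mult_left_mono[OF I, of "61 / 20 * ?n"] by simp
      moreover have "2 / ?X * ((deficiency V E - 1) * (79 / 100 * ?n)) \<le> 2 / ?X * real (card ?A)"
        using cA X D1 unfolding cJ by (intro mult_left_mono) auto
      \<comment> \<open>With \<open>d\<close> for the deficiency,
        \<open>3.05 d - 1.58 (d - 1) = 1.47 d + 1.58\<close>, which is below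
        \<open>1.8962 (d + 1000)\<close>.\<close>
      moreover have "61 / 20 * ?n * (deficiency V E / ?X) - 2 / ?X * ((deficiency V E - 1) * (79 / 100 * ?n))
          = ?n * ((147 / 100 * deficiency V E + 79 / 50) / ?X)"
        using shifted_deficiency_ge by (simp add: field_simps)
      moreover have "?n * ((147 / 100 * deficiency V E + 79 / 50) / ?X) \<le> ?n * (9481 / 5000)"
        using X D1 by (intro mult_left_mono) (auto simp: field_simps)
      ultimately show "61 / 20 * 1 * ?n * (?I / (?I + 1000)) - 2 / ?X * real (card ?A) \<le> 499 / 1000 * (19 / 5) * ?n"
        by linarith
    qed (use AV X D1 in auto)
  qed
qed

end

lemma expander_mono:
  assumes "expander V E" "E \<subseteq> E'"
  shows "expander V E'"
  unfolding expander_def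
proof (intro allI impI)
  fix I S T
  assume c: "I \<subseteq> V \<and> S \<subseteq> V \<and> T \<subseteq> V \<and> card V \<le> 2 * card I \<and> T \<inter> I = {} \<and>
    S \<inter> T = {} \<and> card V \<le> 50 * card S \<and> card V \<le> 50 * card T"
  have "\<exists>e\<in>E. e \<subseteq> I \<or> (\<exists>s\<in>S. \<exists>t\<in>T. e = {s, t})"
    by (rule assms(1)[unfolded expander_def, rule_format, OF c])
  then obtain e where "e \<in> E" "e \<subseteq> I \<or> (\<exists>s\<in>S. \<exists>t\<in>T. e = {s, t})" by (rule bexE)
  then show "\<exists>e\<in>E'. e \<subseteq> I \<or> (\<exists>s\<in>S. \<exists>t\<in>T. e = {s, t})"
    by (intro bexI[of _ e] subsetD[OF assms(2)])
qed

text \<open>All \<open>n\<close> vertices are isolated and the deficiency is \<open>n\<close>,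
  whence \<open>n / n^3\<close>; the exponential factor is the constant
  \<open>exp 700\<close>.\<close>

lemma potential_empty_le:
  assumes V: "finite V" "0 < card V"
  shows "potential V {} \<le> exp 700 / real (card V) ^ 2"
proof -
  interpret konig_state V "{}" by unfold_locales (auto simp: V konig_graph_empty)
  let ?n = "real (card V)"
  have n: "0 < ?n" using V(2) by simp
  have "matching_number ({} :: 'a set set) = 0"
    using konig_pairD(1)[of V "{}" "{}" id] V(1) by (auto simp: konig_pair_def)
  then have d: "deficiency V {} = ?n" by (simp add: deficiency_def)
  have I: "isolated V {} = V" by (auto simp: isolated_def isolated_vertex_def)
  have "shifted_deficiency V {} \<le> ?n + 1000" by (simp add: shifted_deficiency_def d)
  then have "weight V {} \<le> (?n + 1000) * exp 700" using n by (simp add: weight_def d)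
  then have "potential V {} \<le> (?n + 1000) * exp 700 / (?n + 1000) ^ 3"
    unfolding potential_def I using n by (intro divide_right_mono) auto
  also have "\<dots> = exp 700 / (?n + 1000) ^ 2" using n by (simp add: power2_eq_square power3_eq_cube)
  also have "\<dots> \<le> exp 700 / ?n ^ 2" using n by (intro divide_left_mono power_mono) auto
  finally show ?thesis .
qed

section \<open>Survival of isolated vertices\<close>

text \<open>Without isolated vertices the potential is at least \<open>1000^(-3)\<close>, whereas
  its quotient by the accumulated growth factors starts near \<open>n^(-2)\<close> and does not
  increase on average along good prefixes.\<close>

lemma prob_good_without_isolated:
  fixes V :: "'a set" and m0 m :: nat
  defines "n \<equiv> real (card V)"
  defines "Good \<equiv> \<lambda>p. (\<forall>v\<in>V. 100 * card (incident (set p) v) \<le> card V) \<and>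
    (m0 \<le> length p \<longrightarrow> expander V (process_graph V p) \<and>
      999 * card V \<le> 2000 * matching_number (process_graph V p))"
  assumes V: "finite V" and large: "1000000 \<le> card V"
    and m: "m0 \<le> m" "m \<le> card (nsets V 2)" "100000000 * real m \<le> n ^ 2"
  shows "measure_pmf.prob (edge_ordering V)
      {es. isolated V (process_graph V (take m es)) = {} \<and> (\<forall>s<m. Good (take s es))}
    \<le> exp 700 * 1000000000 * ((1 + 8 / n) ^ m0 * (1 + 19 / 5 / n) ^ (m - m0)) / n ^ 2"
proof -
  let ?K = "nsets V 2" and ?G = "process_graph V"
  define r1 where "r1 = 1 + 8 / n"
  define r2 where "r2 = 1 + 19 / 5 / n"
  have n: "0 < n" using large by (simp add: n_def)
  have r: "0 < r1" "0 < r2" using n by (auto simp: r1_def r2_def add_pos_nonneg)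
  \<comment> \<open>Lists with entries other than pairs from \<open>V\<close> get the value 0, since
    positivity of the potential is available only for Koenig graphs on \<open>V\<close>.\<close>
  define \<Phi> where "\<Phi> p = (if set p \<subseteq> ?K
      then potential V (?G p) / (r1 ^ min (length p) m0 * r2 ^ (length p - m0)) else 0)" for p
  define a where "a = 1 / 1000000000 / (r1 ^ m0 * r2 ^ (m - m0))"
  have a: "0 < a" using r by (simp add: a_def)
  have finK: "finite ?K" using V by (simp add: finite_imp_finite_nsets)
  have state: "konig_state V (?G p)" if "set p \<subseteq> ?K" for p
    using V that process_graph_subset process_graph_konig by unfold_locales blast+
  have "measure_pmf.prob (pmf_of_set (permutations_of_set ?K))
      {es. a \<le> \<Phi> (take m es) \<and> (\<forall>s<m. Good (take s es))} \<le> \<Phi> [] / a"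
  proof (rule prob_permutations_le[OF finK m(2) a])
    show "0 \<le> \<Phi> p" for p
      using konig_state.potential_pos[OF state[of p]] r by (auto simp: \<Phi>_def intro!: divide_nonneg_pos)
    fix p assume p: "distinct p" "set p \<subseteq> ?K" "length p < m" "Good p"
    interpret konig_state V "?G p" by (rule state[OF p(2)])
    let ?S = "?K - set p" and ?q = "r1 ^ min (length p) m0 * r2 ^ (length p - m0)"
    have cS: "card ?S = card ?K - length p"
      using p finK by (simp add: card_Diff_subset distinct_card)
    have P: "100000000 * real (card (set p)) \<le> real (card V) ^ 2"
      using p(1,3) m(3) by (simp add: distinct_card n_def)
    define \<rho> where "\<rho> = (if m0 \<le> length p then r2 else r1)"
    have \<rho>: "0 < \<rho>" using r by (simp add: \<rho>_def)
    have "(\<Sum>e\<in>?S. potential V (konig_step V e (?G p))) \<le> real (card ?S) * (\<rho> * potential V (?G p))"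
    proof (cases "m0 \<le> length p")
      case True
      then show ?thesis
        using potential_drift_expander[OF large _ _ p(2) P] p(4)
        by (simp add: \<rho>_def r2_def n_def Good_def)
    next
      case False
      then show ?thesis
        using potential_drift_trivial[of ?S] remaining_pairs[OF V large p(2) P] large
        by (simp add: \<rho>_def r1_def n_def)
    qed
    then have "(\<Sum>e\<in>?S. potential V (konig_step V e (?G p))) / (?q * \<rho>) \<le>
        real (card ?S) * (\<rho> * potential V (?G p)) / (?q * \<rho>)"
      using r \<rho> by (intro divide_right_mono) auto
    moreover have "\<Phi> (p @ [e]) = potential V (konig_step V e (?G p)) / (?q * \<rho>)" if "e \<in> ?S" for e
      using that p(2) by (auto simp: \<Phi>_def \<rho>_def min_def Suc_diff_le mult_ac)
    then have "(\<Sum>e\<in>?S. \<Phi> (p @ [e])) = (\<Sum>e\<in>?S. potential V (konig_step V e (?G p))) / (?q * \<rho>)"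
      by (simp add: sum_divide_distrib)
    moreover have "real (card ?S) * (\<rho> * potential V (?G p)) / (?q * \<rho>) = real (card ?S) * \<Phi> p"
      using p(2) \<rho> by (simp add: \<Phi>_def)
    ultimately show "(\<Sum>e\<in>?S. \<Phi> (p @ [e])) \<le> real (card ?K - length p) * \<Phi> p"
      by (simp only: cS)
  qed
  moreover have "measure_pmf.prob (edge_ordering V)
      {es. isolated V (?G (take m es)) = {} \<and> (\<forall>s<m. Good (take s es))} \<le>
    measure_pmf.prob (edge_ordering V) {es. a \<le> \<Phi> (take m es) \<and> (\<forall>s<m. Good (take s es))}"
  proof -
    have "a \<le> \<Phi> (take m es)"
      if es: "isolated V (?G (take m es)) = {}" "es \<in> set_pmf (edge_ordering V)" for es
    proof -
      have "es \<in> permutations_of_set ?K" using es(2) finK by (simp add: edge_ordering_def)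
      then have l: "length (take m es) = m" and s: "set (take m es) \<subseteq> ?K"
        using m(2) by (auto simp: length_finite_permutations_of_set permutations_of_setD dest: in_set_takeD)
      interpret konig_state V "?G (take m es)" by (rule state[OF s])
      have "1 * 1 \<le> weight V (?G (take m es))"
        unfolding weight_def using shifted_deficiency_ge deficiency_nonneg
        by (intro mult_mono) auto
      then have *: "1 / 1000000000 \<le> potential V (?G (take m es))"
        by (simp add: potential_def es(1))
      have "\<Phi> (take m es) = potential V (?G (take m es)) / (r1 ^ m0 * r2 ^ (m - m0))"
        unfolding \<Phi>_def l min.absorb2[OF m(1)] using s by (rule if_P)
      then show ?thesis
        unfolding a_def using * r by (simp only:) (intro divide_right_mono, auto)
    qed
    then have "{es. isolated V (?G (take m es)) = {} \<and> (\<forall>s<m. Good (take s es))} \<inter>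
        set_pmf (edge_ordering V) \<subseteq> {es. a \<le> \<Phi> (take m es) \<and> (\<forall>s<m. Good (take s es))}" by blast
    then show ?thesis
      by (metis (no_types, lifting) measure_Int_set_pmf measure_pmf.finite_measure_mono sets_measure_pmf UNIV_I)
  qed
  moreover have "\<Phi> [] / a \<le> exp 700 * 1000000000 * (r1 ^ m0 * r2 ^ (m - m0)) / n ^ 2"
  proof -
    have "\<Phi> [] \<le> exp 700 / n ^ 2"
      using potential_empty_le[OF V] large by (simp add: \<Phi>_def n_def)
    then have "\<Phi> [] / a \<le> exp 700 / n ^ 2 / a" using a by (intro divide_right_mono) auto
    then show ?thesis using r by (simp add: a_def mult_ac)
  qed
  ultimately show ?thesis unfolding edge_ordering_def r1_def r2_def by linarith
qed

text \<open>Outside the exceptional events \<open>A2\<close>, \<open>A3\<close> and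
  \<open>A4\<close> all prefixes shorter than \<open>m\<close> are good: offered degrees only grow,
  so time \<open>m\<close> controls the earlier ones, while expansion and the matching number cannot
  get worse after time \<open>m0\<close>.\<close>

lemma prob_no_isolated:
  fixes V :: "'a set" and m0 m :: nat
  defines "n \<equiv> real (card V)"
  assumes V: "finite V" and large: "1000000 \<le> card V"
    and m: "m0 \<le> m" "m \<le> card (nsets V 2)" "100000000 * real m \<le> n ^ 2"
  shows "measure_pmf.prob (edge_ordering V)
      {es. \<not> (\<exists>v. isolated_vertex V (konig_process V es m) v)}
    \<le> exp 700 * 1000000000 * ((1 + 8 / n) ^ m0 * (1 + 19 / 5 / n) ^ (m - m0)) / n ^ 2
      + n * ((1 + 3 / n) ^ m / 2 ^ (card V div 100))
      + 16 ^ card V * (1 - (1/2000000) / 2) ^ m0 + 2 ^ card V * (1 - (1/2000000) / 2) ^ m0"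
proof -
  let ?G = "\<lambda>t es. process_graph V (take t es)" and ?pr = "measure_pmf.prob (edge_ordering V)"
  define Good where "Good p \<longleftrightarrow> (\<forall>v\<in>V. 100 * card (incident (set p) v) \<le> card V) \<and>
    (m0 \<le> length p \<longrightarrow> expander V (process_graph V p) \<and>
      999 * card V \<le> 2000 * matching_number (process_graph V p))" for p
  define A1 where "A1 = {es. isolated V (?G m es) = {} \<and> (\<forall>s<m. Good (take s es))}"
  define A2 where "A2 = {es. \<exists>v\<in>V. card V < 100 * card (incident (set (take m es)) v)}"
  define A3 where "A3 = {es. \<not> expander V (?G m0 es)}"
  define A4 where "A4 = {es. 2000 * matching_number (?G m0 es) < 999 * card V}"
  have "{es. \<not> (\<exists>v. isolated_vertex V (konig_process V es m) v)} \<inter> set_pmf (edge_ordering V) \<subseteq>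
      A1 \<union> (A2 \<union> (A3 \<union> A4))"
  proof
    fix es assume es: "es \<in> {es. \<not> (\<exists>v. isolated_vertex V (konig_process V es m) v)} \<inter> set_pmf (edge_ordering V)"
    then have "es \<in> permutations_of_set (nsets V 2)"
      using V by (simp add: edge_ordering_def finite_imp_finite_nsets)
    then have l: "length es = card (nsets V 2)" and s: "set es = nsets V 2"
      by (auto simp: length_finite_permutations_of_set permutations_of_setD)
    have I: "isolated V (?G m es) = {}"
      using es process_graph_take[of m es V] m(2) l by (simp add: isolated_def)
    show "es \<in> A1 \<union> (A2 \<union> (A3 \<union> A4))"
    proof (rule ccontr)
      assume no: "es \<notin> A1 \<union> (A2 \<union> (A3 \<union> A4))"
      have "Good (take k es)" if "k < m" for k
        unfolding Good_def
      proof (intro conjI ballI impI)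
        fix v assume "v \<in> V"
        then have "100 * card (incident (set (take m es)) v) \<le> card V" using no by (auto simp: A2_def not_less)
        moreover have "incident (set (take k es)) v \<subseteq> incident (set (take m es)) v"
          using set_take_subset_set_take[of k m es] that by (auto simp: incident_def)
        then have "card (incident (set (take k es)) v) \<le> card (incident (set (take m es)) v)"
          by (intro card_mono) (auto simp: incident_def)
        ultimately show "100 * card (incident (set (take k es)) v) \<le> card V" by linarith
      next
        assume "m0 \<le> length (take k es)"
        then have mono: "?G m0 es \<subseteq> ?G k es" by (intro process_graph_mono) simp
        have "expander V (?G m0 es)" using no by (auto simp: A3_def)
        then show "expander V (?G k es)" using mono by (rule expander_mono)
        have "finite (?G k es)" by (rule finite_subset[OF process_graph_subset]) simp
        then have "matching_number (?G m0 es) \<le> matching_number (?G k es)"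
          using mono by (rule matching_number_mono)
        moreover have "\<not> 2000 * matching_number (?G m0 es) < 999 * card V" using no by (auto simp: A4_def)
        ultimately show "999 * card V \<le> 2000 * matching_number (?G k es)" by linarith
      qed
      then show False using no I by (auto simp: A1_def)
    qed
  qed
  then have "?pr {es. \<not> (\<exists>v. isolated_vertex V (konig_process V es m) v)} \<le> ?pr (A1 \<union> (A2 \<union> (A3 \<union> A4)))"
    by (metis (no_types, lifting) measure_Int_set_pmf measure_pmf.finite_measure_mono sets_measure_pmf UNIV_I)
  also have "\<dots> \<le> ?pr A1 + (?pr A2 + (?pr A3 + ?pr A4))"
    by (intro order_trans[OF measure_Un_le] add_left_mono) auto
  finally have "?pr {es. \<not> (\<exists>v. isolated_vertex V (konig_process V es m) v)} \<le>
      ?pr A1 + (?pr A2 + (?pr A3 + ?pr A4))" .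
  moreover have "?pr A1 \<le> exp 700 * 1000000000 * ((1 + 8 / n) ^ m0 * (1 + 19 / 5 / n) ^ (m - m0)) / n ^ 2"
    using prob_good_without_isolated[OF V large m[unfolded n_def]]
    unfolding A1_def Good_def n_def by simp
  moreover have "?pr A2 \<le> n * ((1 + 3 / n) ^ m / 2 ^ (card V div 100))"
    using prob_large_degree[OF V large m(2)] m(3) unfolding A2_def n_def by simp
  moreover have m0: "m0 \<le> card (nsets V 2)" "100000000 * real m0 \<le> real (card V) ^ 2"
    using m unfolding n_def by linarith+
  have "?pr A3 \<le> 16 ^ card V * (1 - (1/2000000) / 2) ^ m0"
    unfolding A3_def by (rule prob_not_expander[OF V large m0])
  moreover have "?pr A4 \<le> 2 ^ card V * (1 - (1/2000000) / 2) ^ m0"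
    unfolding A4_def by (rule prob_large_deficiency[OF V large m0])
  ultimately show ?thesis by linarith
qed

section \<open>Asymptotic estimates\<close>

lemma power_one_plus_le_exp:
  fixes x :: real
  assumes "-1 \<le> x" shows "(1 + x) ^ k \<le> exp (x * real k)"
proof -
  have "(1 + x) ^ k \<le> exp x ^ k"
    using assms exp_ge_add_one_self[of x] by (intro power_mono) auto
  then show ?thesis by (simp add: exp_of_nat_mult[symmetric] mult.commute)
qed

text \<open>The exponents are \<open>1/2 + 1/70 = 18 / 35\<close> times the rates
  \<open>19 / 5\<close> and \<open>3\<close>; \<open>320000000\<close> is 8 times the
  \<open>40000000\<close> early steps per vertex. The first summand vanishes in the limit because
  \<open>342 / 175 < 2\<close>.\<close>

definition failure_bound :: "nat \<Rightarrow> real" where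
  "failure_bound n = exp 700 * 1000000000 * exp 320000000 *
      (exp (19 / 5 / real n) * real n powr (342 / 175) / real n ^ 2)
    + real n * (exp (3 / real n) * real n powr (54 / 35)) / 2 powr (real n / 100 - 1)
    + 2 * (1 / 2) ^ n"

lemma failure_bound_tendsto: "failure_bound \<longlonglongrightarrow> 0"
proof -
  have "(\<lambda>n. exp (19 / 5 / real n) * real n powr (342 / 175) / real n ^ 2) \<longlonglongrightarrow> 0"
    by real_asymp
  then have "(\<lambda>n. exp 700 * 1000000000 * exp 320000000 *
      (exp (19 / 5 / real n) * real n powr (342 / 175) / real n ^ 2)) \<longlonglongrightarrow> 0"
    by (rule tendsto_mult_right_zero)
  moreover have "(\<lambda>n. real n * (exp (3 / real n) * real n powr (54 / 35)) / 2 powr (real n / 100 - 1)) \<longlonglongrightarrow> 0"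
    by real_asymp
  moreover have "(\<lambda>n. 2 * (1 / 2) ^ n :: real) \<longlonglongrightarrow> 0"
    by real_asymp
  ultimately have "failure_bound \<longlonglongrightarrow> 0 + 0 + 0"
    unfolding failure_bound_def by (intro tendsto_add)
  then show ?thesis by simp
qed

lemma prob_no_isolated_le_failure_bound:
  fixes V :: "'a set" and m :: nat
  defines "n \<equiv> real (card V)"
  assumes V: "finite V" and large: "1000000 \<le> card V"
    and m: "\<bar>real m - (1/2 + 1/70) * n * ln n\<bar> < 1"
    and ln: "100000000 \<le> ln n" and sq: "100000000 * ((1/2 + 1/70) * n * ln n + 1) \<le> n ^ 2"
  shows "measure_pmf.prob (edge_ordering V)
      {es. \<not> (\<exists>v. isolated_vertex V (konig_process V es m) v)} \<le> failure_bound (card V)"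
proof -
  \<comment> \<open>After this many steps the early-phase factor is at most
    \<open>exp (-10 n)\<close>, which beats the \<open>16^n\<close> of the union bound.\<close>
  let ?m0 = "40000000 * card V"
  have n: "1000000 \<le> n" using large by (simp add: n_def)
  have mu: "real m \<le> (1/2 + 1/70) * n * ln n + 1" using m by linarith
  have m3: "100000000 * real m \<le> n ^ 2"
    by (rule order_trans[OF mult_left_mono[OF mu] sq]) simp
  have nn: "1000000 * n \<le> n ^ 2" using n by (simp add: power2_eq_square mult_right_mono)
  \<comment> \<open>For \<open>ln n\<close> this large, \<open>m\<close> exceeds
    \<open>51000000 n\<close> and so lies beyond the early phase.\<close>
  have "n * 100000000 \<le> n * ln n" using ln n by (intro mult_left_mono) auto
  moreover have "(1/2 + 1/70) * n * ln n = 18 / 35 * (n * ln n)" by simp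
  then have "18 / 35 * (n * ln n) - 1 \<le> real m" using m by linarith
  moreover have "real ?m0 = 40000000 * n" by (simp add: n_def)
  ultimately have "real ?m0 \<le> real m" using n by linarith
  then have m1: "?m0 \<le> m" by linarith
  have "real (card (nsets V 2)) = (n ^ 2 - n) / 2"
    unfolding card_complete_graph[OF V] n_def power2_eq_square by (simp add: algebra_simps)
  moreover have "real m \<le> (q - n) / 2" if "100000000 * real m \<le> q" "1000000 * n \<le> q" for q
    using that n by simp
  then have "real m \<le> (n ^ 2 - n) / 2" using m3 nn by blast
  ultimately have "real m \<le> real (card (nsets V 2))" by (simp only:)
  then have m2: "m \<le> card (nsets V 2)" by linarith
  have mn: "real m / n \<le> 18 / 35 * ln n + 1 / n"
  proof -
    have "real m / n \<le> ((1/2 + 1/70) * n * ln n + 1) / n" using mu n by (intro divide_right_mono) auto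
    then show ?thesis using n by (simp add: add_divide_distrib)
  qed
  have growth: "(1 + c / n) ^ k \<le> exp (c / n) * n powr (18 / 35 * c)" if "0 \<le> c" "k \<le> m" for c k
  proof -
    have "(1 + c / n) ^ k \<le> (1 + c / n) ^ m" using that n by (intro power_increasing) auto
    also have "\<dots> \<le> exp (c / n * real m)"
    proof (rule power_one_plus_le_exp)
      have "0 \<le> c / n" using that n by simp
      then show "- 1 \<le> c / n" by linarith
    qed
    also have "c / n * real m = c * (real m / n)" by simp
    also have "exp (c * (real m / n)) \<le> exp (c * (18 / 35 * ln n + 1 / n))"
      using mult_left_mono[OF mn that(1)] by (simp only: exp_le_cancel_iff)
    also have "\<dots> = exp (c / n) * n powr (18 / 35 * c)"
      using n by (simp add: powr_def exp_add[symmetric] algebra_simps)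
    finally show ?thesis .
  qed
  let ?r = "1 - (1/2000000) / 2 :: real"
  have r: "?r ^ ?m0 \<le> (1 / 32) ^ card V"
  proof -
    have "(1 + (- 1 / 4000000 :: real)) ^ 40000000 \<le> exp ((- 1 / 4000000) * real 40000000)"
      by (rule power_one_plus_le_exp) simp
    also have "\<dots> = 1 / exp 1 ^ 10" by (simp add: exp_minus field_simps flip: exp_of_nat_mult)
    also have "\<dots> \<le> 1 / 2 ^ 10"
      using exp_ge_add_one_self[of 1] by (intro divide_left_mono power_mono) auto
    also have "\<dots> \<le> (1 / 32 :: real)" by simp
    finally have "?r ^ 40000000 \<le> 1 / 32" by simp
    then have "(?r ^ 40000000) ^ card V \<le> (1 / 32) ^ card V" by (intro power_mono) auto
    then show ?thesis by (simp only: power_mult)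
  qed
  have "(1 + 8 / n) ^ ?m0 \<le> exp (8 / n * real ?m0)"
  proof (rule power_one_plus_le_exp)
    have "0 \<le> 8 / n" using n by simp
    then show "- 1 \<le> 8 / n" by linarith
  qed
  also have "8 / n * real ?m0 = 320000000" using n by (simp add: n_def)
  finally have e1: "(1 + 8 / n) ^ ?m0 \<le> exp 320000000" .
  have "measure_pmf.prob (edge_ordering V)
      {es. \<not> (\<exists>v. isolated_vertex V (konig_process V es m) v)}
    \<le> exp 700 * 1000000000 * ((1 + 8 / n) ^ ?m0 * (1 + 19 / 5 / n) ^ (m - ?m0)) / n ^ 2
      + n * ((1 + 3 / n) ^ m / 2 ^ (card V div 100))
      + 16 ^ card V * ?r ^ ?m0 + 2 ^ card V * ?r ^ ?m0"
    using prob_no_isolated[OF V large m1 m2 m3[unfolded n_def]] unfolding n_def .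
  also have "\<dots> \<le> exp 700 * 1000000000 * (exp 320000000 * (exp (19 / 5 / n) * n powr (342 / 175))) / n ^ 2
      + n * ((exp (3 / n) * n powr (54 / 35)) / 2 powr (n / 100 - 1))
      + 16 ^ card V * (1 / 32) ^ card V + 16 ^ card V * (1 / 32) ^ card V"
  proof (intro add_mono)
    have "(1 + 19 / 5 / n) ^ (m - ?m0) \<le> exp (19 / 5 / n) * n powr (342 / 175)"
      using growth[of "19 / 5" "m - ?m0"] by simp
    then show "exp 700 * 1000000000 * ((1 + 8 / n) ^ ?m0 * (1 + 19 / 5 / n) ^ (m - ?m0)) / n ^ 2 \<le>
        exp 700 * 1000000000 * (exp 320000000 * (exp (19 / 5 / n) * n powr (342 / 175))) / n ^ 2"
      using e1 n by (intro divide_right_mono mult_left_mono mult_mono) auto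
    have "2 powr (n / 100 - 1) \<le> 2 powr real (card V div 100)"
    proof (rule powr_mono)
      have "card V \<le> 100 * (card V div 100) + 100" by linarith
      then have "n \<le> 100 * real (card V div 100) + 100" unfolding n_def by linarith
      then show "n / 100 - 1 \<le> real (card V div 100)" by linarith
    qed simp
    also have "\<dots> = 2 ^ (card V div 100)" by (rule powr_realpow) simp
    finally have "2 powr (n / 100 - 1) \<le> 2 ^ (card V div 100)" .
    moreover have "(1 + 3 / n) ^ m \<le> exp (3 / n) * n powr (54 / 35)"
      using growth[of 3 m] by simp
    ultimately show "n * ((1 + 3 / n) ^ m / 2 ^ (card V div 100)) \<le>
        n * ((exp (3 / n) * n powr (54 / 35)) / 2 powr (n / 100 - 1))"
      using n by (intro mult_left_mono frac_le) auto
    show "16 ^ card V * ?r ^ ?m0 \<le> 16 ^ card V * (1 / 32) ^ card V"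
      using r by (intro mult_left_mono) auto
    have "(2::real) ^ card V \<le> 16 ^ card V" by (intro power_mono) auto
    then show "2 ^ card V * ?r ^ ?m0 \<le> 16 ^ card V * (1 / 32) ^ card V"
      using r by (intro mult_mono) auto
  qed
  also have "16 ^ card V * (1 / 32) ^ card V = (16 * (1 / 32) :: real) ^ card V"
    by (simp only: power_mult_distrib)
  finally show ?thesis by (simp add: failure_bound_def n_def)
qed

theorem theorem1p3:
  fixes V :: "nat \<Rightarrow> 'a set" and m :: "nat \<Rightarrow> nat"
  assumes V: "\<And>n. even n \<Longrightarrow> finite (V n) \<and> card (V n) = n"
    and m: "\<And>n. even n \<Longrightarrow> \<bar>real (m n) - (1/2 + 1/70) * real n * ln (real n)\<bar> < 1"
  shows "((\<lambda>n. measure_pmf.prob (edge_ordering (V n))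
              {es. \<exists>v. isolated_vertex (V n) (konig_process (V n) es (m n)) v})
            \<longlongrightarrow> 1) (inf sequentially (principal {n. even n}))"
proof -
  let ?F = "inf sequentially (principal {n. even n})"
  let ?pr = "\<lambda>n. measure_pmf.prob (edge_ordering (V n))
      {es. \<exists>v. isolated_vertex (V n) (konig_process (V n) es (m n)) v}"
  have "eventually (\<lambda>n. 1000000 \<le> n) sequentially" by (rule eventually_ge_at_top)
  moreover have "eventually (\<lambda>n. 100000000 \<le> ln (real n)) sequentially" by real_asymp
  moreover have "eventually (\<lambda>n. 100000000 * ((1/2 + 1/70) * real n * ln (real n) + 1) \<le> real n ^ 2) sequentially"
    by real_asymp
  \<comment> \<open>Nothing is known about \<open>V n\<close> for odd \<open>n\<close>, so parity is
    a premise here and moves into the filter afterwards.\<close>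
  ultimately have "eventually (\<lambda>n. even n \<longrightarrow> 1 - failure_bound n \<le> ?pr n) sequentially"
  proof eventually_elim
    case (elim n)
    show ?case
    proof
      assume ev: "even n"
      let ?A = "{es. \<exists>v. isolated_vertex (V n) (konig_process (V n) es (m n)) v}"
      have c: "card (V n) = n" and fin: "finite (V n)" using V[OF ev] by auto
      have "measure_pmf.prob (edge_ordering (V n))
          {es. \<not> (\<exists>v. isolated_vertex (V n) (konig_process (V n) es (m n)) v)} \<le> failure_bound (card (V n))"
        by (rule prob_no_isolated_le_failure_bound) (use fin elim m[OF ev] in \<open>simp_all only: c\<close>)
      moreover have "measure_pmf.prob (edge_ordering (V n)) (UNIV - ?A) = 1 - ?pr n"
        using measure_pmf.prob_compl[of ?A "edge_ordering (V n)"] by simp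
      moreover have "UNIV - ?A = {es. \<not> (\<exists>v. isolated_vertex (V n) (konig_process (V n) es (m n)) v)}"
        by auto
      ultimately show "1 - failure_bound n \<le> ?pr n" using c by simp
    qed
  qed
  then have lower: "eventually (\<lambda>n. 1 - failure_bound n \<le> ?pr n) ?F"
    by (simp add: eventually_inf_principal)
  have "((\<lambda>n. 1 - failure_bound n) \<longlongrightarrow> 1 - 0) ?F"
    by (rule tendsto_mono[OF inf_le1 tendsto_diff[OF tendsto_const failure_bound_tendsto]])
  then have lim: "((\<lambda>n. 1 - failure_bound n) \<longlongrightarrow> 1) ?F" by simp
  show ?thesis
    by (rule tendsto_sandwich[OF lower _ lim tendsto_const]) simp
qed

end
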